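(* Let $n\ge 1$ be an integer, let $0<\gamma<\sqrt{3/13}$, and let $$h(y)=\frac{2\gamma}{(\gamma^2+1)\pi}\begin{cases}1-\cos(\pi y), & 0\le y\le 2n+1,\\ 2, & y>2n+1.\end{cases}$$ Consider the planar piecewise linear system with two zones, for $X=(x,y)\in\mathbb{R}^2$, $$X'=\begin{cases}G^-X & \text{if } H(X)<0,\\ G^+X & \text{if } H(X)\ge 0,\end{cases}\qquad G^{\pm}=\begin{pmatrix}\pm 2\gamma&-1\\ \gamma^2+1&0\end{pmatrix},\qquad H(x,y)=\begin{cases}x & \text{if } y\le 0,\\ x-h(y) & \text{if } y>0.\end{cases}$$ Then this system has exactly $n$ limit cycles. These limit cycles are nested and surround the origin, which is a stable singular point of focus type. The limit cycles cut the $y$-axis at the points $(0,2k)$ and $(0,-2k\,e^{-\pi\gamma})$ for $k=1,\dots,n$, and all of them are semi-stable.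
   Context: Solutions are understood by concatenation: a solution is a continuous curve that follows the linear flow of $G^-$ in $\{H<0\}$ and that of $G^+$ in $\{H>0\}$, passing from one zone to the other across $\{H=0\}$ (both fields cross the switching curve in the same direction, so there is no sliding). A limit cycle is an isolated (nonconstant) periodic orbit. It is stable (resp. unstable) from the interior if all orbits starting near it in its interior converge to it as $t\to+\infty$ (resp. $t\to-\infty$), and similarly from the exterior. A limit cycle is semi-stable if it is stable from the interior and unstable from the exterior, or vice versa. "Stable singular point of focus type" means that the origin is an equilibrium and that nearby nonconstant orbits spiral around it and converge to it as $t\to+\infty$. *)

theory Defs
  imports "HOL-Analysis.Analysis"
begin

text \<open>Only the values at nonnegative arguments matter; the cosine branch is not cut off below 0.\<close>
definition h :: "nat \<Rightarrow> real \<Rightarrow> real \<Rightarrow> real" where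
  "h n \<gamma> y = 2 * \<gamma> / ((\<gamma>\<^sup>2 + 1) * pi) *
     (if y \<le> 2 * real n + 1 then 1 - cos (pi * y) else 2)"

definition G_plus :: "real \<Rightarrow> real^2^2" where
  "G_plus \<gamma> = vector [vector [2 * \<gamma>, -1], vector [\<gamma>\<^sup>2 + 1, 0]]"

definition G_minus :: "real \<Rightarrow> real^2^2" where
  "G_minus \<gamma> = vector [vector [- 2 * \<gamma>, -1], vector [\<gamma>\<^sup>2 + 1, 0]]"

definition H :: "nat \<Rightarrow> real \<Rightarrow> real^2 \<Rightarrow> real" where
  "H n \<gamma> p = (if p $ 2 \<le> 0 then p $ 1 else p $ 1 - h n \<gamma> (p $ 2))"

definition pw_field :: "nat \<Rightarrow> real \<Rightarrow> real^2 \<Rightarrow> real^2" where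
  "pw_field n \<gamma> p = (if H n \<gamma> p < 0 then G_minus \<gamma> *v p else G_plus \<gamma> *v p)"

text \<open>
  The curve has to pass from one open zone to the other at a time where it meets the switching
  curve away from the origin; this excludes curves that slide along \<open>{H = 0}\<close>.
  The origin lies on the switching curve as well, but both linear fields vanish there, so at the
  origin the differential equation itself is required instead of a crossing.
\<close>
definition crosses :: "(real \<Rightarrow> real) \<Rightarrow> real \<Rightarrow> bool" where
  "crosses g t \<longleftrightarrow> (\<exists>\<epsilon>>0.
     ((\<forall>s\<in>{t-\<epsilon><..<t}. g s < 0) \<and> (\<forall>s\<in>{t<..<t+\<epsilon>}. g s > 0)) \<or>
     ((\<forall>s\<in>{t-\<epsilon><..<t}. g s > 0) \<and> (\<forall>s\<in>{t<..<t+\<epsilon>}. g s < 0)))"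

definition pw_solution :: "nat \<Rightarrow> real \<Rightarrow> (real \<Rightarrow> real^2) \<Rightarrow> bool" where
  "pw_solution n \<gamma> X \<longleftrightarrow>
     continuous_on UNIV X \<and>
     (\<forall>t. H n \<gamma> (X t) \<noteq> 0 \<or> X t = 0 \<longrightarrow>
        (X has_vector_derivative pw_field n \<gamma> (X t)) (at t)) \<and>
     (\<forall>t. H n \<gamma> (X t) = 0 \<and> X t \<noteq> 0 \<longrightarrow> crosses (\<lambda>s. H n \<gamma> (X s)) t)"

definition periodic_orbit :: "nat \<Rightarrow> real \<Rightarrow> (real^2) set \<Rightarrow> bool" where
  "periodic_orbit n \<gamma> \<Gamma> \<longleftrightarrow> (\<exists>X T. pw_solution n \<gamma> X \<and> T > 0 \<and>
     (\<forall>t. X (t + T) = X t) \<and> \<not> (\<exists>p. \<forall>t. X t = p) \<and> \<Gamma> = range X)"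

definition limit_cycle :: "nat \<Rightarrow> real \<Rightarrow> (real^2) set \<Rightarrow> bool" where
  "limit_cycle n \<gamma> \<Gamma> \<longleftrightarrow> periodic_orbit n \<gamma> \<Gamma> \<and>
     (\<exists>U. open U \<and> \<Gamma> \<subseteq> U \<and> (\<forall>\<Gamma>'. periodic_orbit n \<gamma> \<Gamma>' \<and> \<Gamma>' \<subseteq> U \<longrightarrow> \<Gamma>' = \<Gamma>))"

text \<open>
  The time direction is the filter \<open>F\<close> (\<open>at_top\<close> or \<open>at_bot\<close>) and the side of the cycle is the
  set \<open>A\<close>. The existence clause says that every nearby point of \<open>A\<close> has an orbit, so
  that the quantification over orbits is never vacuous.
\<close>
definition attracts_from :: "nat \<Rightarrow> real \<Rightarrow> real filter \<Rightarrow> (real^2) set \<Rightarrow> (real^2) set \<Rightarrow> bool" where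
  "attracts_from n \<gamma> F A \<Gamma> \<longleftrightarrow> (\<exists>\<epsilon>>0. \<forall>p\<in>A. infdist p \<Gamma> < \<epsilon> \<longrightarrow>
     (\<exists>X. pw_solution n \<gamma> X \<and> X 0 = p) \<and>
     (\<forall>X. pw_solution n \<gamma> X \<and> X 0 = p \<longrightarrow> ((\<lambda>t. infdist (X t) \<Gamma>) \<longlongrightarrow> 0) F))"

definition stable_interior :: "nat \<Rightarrow> real \<Rightarrow> (real^2) set \<Rightarrow> bool" where
  "stable_interior n \<gamma> \<Gamma> \<longleftrightarrow> attracts_from n \<gamma> at_top (inside \<Gamma>) \<Gamma>"

definition unstable_interior :: "nat \<Rightarrow> real \<Rightarrow> (real^2) set \<Rightarrow> bool" where
  "unstable_interior n \<gamma> \<Gamma> \<longleftrightarrow> attracts_from n \<gamma> at_bot (inside \<Gamma>) \<Gamma>"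

definition stable_exterior :: "nat \<Rightarrow> real \<Rightarrow> (real^2) set \<Rightarrow> bool" where
  "stable_exterior n \<gamma> \<Gamma> \<longleftrightarrow> attracts_from n \<gamma> at_top (outside \<Gamma>) \<Gamma>"

definition unstable_exterior :: "nat \<Rightarrow> real \<Rightarrow> (real^2) set \<Rightarrow> bool" where
  "unstable_exterior n \<gamma> \<Gamma> \<longleftrightarrow> attracts_from n \<gamma> at_bot (outside \<Gamma>) \<Gamma>"

definition semi_stable :: "nat \<Rightarrow> real \<Rightarrow> (real^2) set \<Rightarrow> bool" where
  "semi_stable n \<gamma> \<Gamma> \<longleftrightarrow>
     stable_interior n \<gamma> \<Gamma> \<and> unstable_exterior n \<gamma> \<Gamma> \<or>
     unstable_interior n \<gamma> \<Gamma> \<and> stable_exterior n \<gamma> \<Gamma>"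

text \<open>A continuous determination of the polar angle along the forward orbit is unbounded.\<close>
definition spirals_around_origin :: "(real \<Rightarrow> real^2) \<Rightarrow> bool" where
  "spirals_around_origin X \<longleftrightarrow> (\<exists>\<theta>. continuous_on {0..} \<theta> \<and>
     (\<forall>t\<ge>0. X t \<noteq> 0 \<and> X t = norm (X t) *\<^sub>R vector [cos (\<theta> t), sin (\<theta> t)]) \<and>
     (filterlim \<theta> at_top at_top \<or> filterlim \<theta> at_bot at_top))"

text \<open>The origin being an equilibrium, the nearby nonconstant orbits are those through \<open>p \<noteq> 0\<close>.\<close>
definition stable_focus_at_origin :: "nat \<Rightarrow> real \<Rightarrow> bool" where
  "stable_focus_at_origin n \<gamma> \<longleftrightarrow>
     pw_solution n \<gamma> (\<lambda>_. 0) \<and>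
     (\<exists>\<epsilon>>0. \<forall>p. p \<noteq> 0 \<and> norm p < \<epsilon> \<longrightarrow>
        (\<exists>X. pw_solution n \<gamma> X \<and> X 0 = p) \<and>
        (\<forall>X. pw_solution n \<gamma> X \<and> X 0 = p \<longrightarrow>
           spirals_around_origin X \<and> (X \<longlongrightarrow> 0) at_top))"

definition nested :: "(real^2) set set \<Rightarrow> bool" where
  "nested \<C> \<longleftrightarrow> (\<forall>\<Gamma>\<in>\<C>. \<forall>\<Gamma>'\<in>\<C>. \<Gamma> \<noteq> \<Gamma>' \<longrightarrow>
     \<Gamma> \<union> inside \<Gamma> \<subseteq> inside \<Gamma>' \<or> \<Gamma>' \<union> inside \<Gamma>' \<subseteq> inside \<Gamma>)"

end

(* If the switching line were the whole y-axis, the two flows r' = g r and r' = - g r (g = gamma, in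
   suitable polar coordinates) would cancel over a full turn and the origin would be a centre, whose
   orbits are the level sets of a homogeneous gauge N.  For the actual system N is constant along
   orbits except in the region D = {0 < x < h(y), y > 0}, where the field G^- replaces G^+ and N
   strictly decreases, while the polar angle increases at speed at least 1 everywhere.  So N is
   nonincreasing along every solution, and if N(X t) tends to a positive limit then the top point
   (0, y) of the limiting level set satisfies h(y) = 0, that is y = 2k with 1 <= k <= n.  The level
   sets through (0, 2k) do not meet D, because gamma < sqrt(3/13) makes the switching curve
   transversal to both flows; they are therefore the periodic orbits.  They cannot be crossed
   outwards to inwards, so orbits starting outside are caught by them in forward time and orbits
   starting inside come from them in backward time. *)

theory Submission
  imports Defs
begin

section \<open>Real-variable preliminaries\<close>

text \<open>Stability quantifies over all solutions through a point, and away from the origin a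
  solution is merely continuous where it meets the switching curve. Facts about solutions are
  therefore drawn from differential inequalities that hold off a locally finite set of times.
  Crossings isolate these times; the origin, where no crossing is demanded, is kept out of reach by
  a growth estimate. Existence is a separate construction: explicit arcs of the two linear flows are
  glued into a bi-infinite chain of turns. The bound on gamma enters once. It says 4 g^2 / (g^2 + 1)
  < 3/4, which combines with (1 - cos (pi y)) (1 - sin (pi y)) <= 4 y and pi > 3 to make the
  derivative of x - h(y) negative along both fields on the switching curve.\<close>

lemma has_vector_derivative_vec2_iff:
  fixes X :: "real \<Rightarrow> real^2"
  shows "(X has_vector_derivative v) (at t) \<longleftrightarrow>
    ((\<lambda>t. X t $ 1) has_real_derivative v $ 1) (at t) \<and>
    ((\<lambda>t. X t $ 2) has_real_derivative v $ 2) (at t)"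
proof -
  have *: "(\<lambda>x. x * r) = (*) r" for r :: real by (simp add: fun_eq_iff)
  show ?thesis
    unfolding has_vector_derivative_def has_field_derivative_def
    by (subst has_derivative_componentwise_within) (simp add: Basis_vec_def inner_axis UNIV_2 * conj_commute)
qed

lemma continuous_on_vector2 [continuous_intros]:
  fixes f f' :: "'a::topological_space \<Rightarrow> real"
  assumes "continuous_on S f" "continuous_on S f'"
  shows "continuous_on S (\<lambda>x. vector [f x, f' x] :: real^2)"
proof -
  have "(vector [a, b] :: real^2) = a *\<^sub>R axis 1 1 + b *\<^sub>R axis 2 1" for a b
    by (simp add: vec_eq_iff forall_2 axis_def)
  then show ?thesis by (simp only:) (intro continuous_intros assms)
qed

text \<open>Extended by 0 over the exceptional points, the derivative still integrates to
  \<open>f b - f a\<close>, because \<open>f\<close> is continuous. This stands in for the mean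
  value theorem along solutions with finitely many switching times.\<close>

lemma nonincreasing_if_deriv_nonpos_finite:
  fixes f :: "real \<Rightarrow> real"
  assumes "a \<le> b" "continuous_on {a..b} f" "finite S"
    and der: "\<And>t. \<lbrakk>a < t; t < b; t \<notin> S\<rbrakk> \<Longrightarrow> \<exists>d\<le>0. (f has_real_derivative d) (at t)"
  shows "f b \<le> f a"
proof -
  obtain f' where f': "\<And>t. t \<in> {a<..<b} - S \<Longrightarrow> f' t \<le> 0 \<and> (f has_real_derivative f' t) (at t)"
    using der by (metis DiffE greaterThanLessThan_iff)
  define f'' where "f'' t = (if t \<in> {a<..<b} - S then f' t else 0)" for t
  have "(f'' has_integral (f b - f a)) {a..b}"
    using assms(1-3) f'
    by (intro fundamental_theorem_of_calculus_interior_strong[of S])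
       (auto simp: f''_def has_real_derivative_iff_has_vector_derivative)
  moreover have "\<And>t. f'' t \<le> 0" using f' by (auto simp: f''_def)
  ultimately show ?thesis
    using has_integral_le[of f'' "f b - f a" "{a..b}" "\<lambda>_. 0" 0] by auto
qed

text \<open>Every zero is crossed downwards, so a return to 0 after a zero would have to arrive from
  negative values with negative slope. The value at \<open>a\<close> itself may be 0: the orbits of
  interest start on the switching curve.\<close>

lemma sign_change_unique:
  fixes f :: "real \<Rightarrow> real"
  assumes cont: "continuous_on UNIV f"
    and der: "\<And>t. \<lbrakk>a < t; t \<le> b; f t = 0\<rbrakk> \<Longrightarrow> \<exists>d<0. (f has_real_derivative d) (at t)"
    and start: "a < u" "u < b" "\<And>t. \<lbrakk>a < t; t \<le> u\<rbrakk> \<Longrightarrow> f t > 0"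
    and "f b \<le> 0"
  obtains z where "a < z" "z \<le> b" "f z = 0"
    "\<And>t. \<lbrakk>a < t; t < z\<rbrakk> \<Longrightarrow> f t > 0" "\<And>t. \<lbrakk>z < t; t \<le> b\<rbrakk> \<Longrightarrow> f t < 0"
proof -
  have cont': "continuous_on S f" for S using cont continuous_on_subset by blast
  have after: "f t < 0" if z: "a < z" "f z = 0" and t: "z < t" "t \<le> b" for z t
  proof (rule ccontr)
    assume nt: "\<not> f t < 0"
    obtain d where "d < 0" "(f has_real_derivative d) (at z)"
      using der[of z] z t by auto
    then obtain e where e: "e > 0" "\<And>k. \<lbrakk>0 < k; k < e\<rbrakk> \<Longrightarrow> f (z + k) < f z"
      using DERIV_neg_dec_right by blast
    define z' where "z' = z + min (e/2) ((t - z)/2)"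
    have z': "z < z'" "z' < t" "f z' < 0" "\<And>s. \<lbrakk>z < s; s \<le> z'\<rbrakk> \<Longrightarrow> f s < 0"
    proof -
      have *: "f s < 0" if "z < s" "s \<le> z'" for s
        using e(2)[of "s - z"] that e(1) z t by (auto simp: z'_def min_def field_simps split: if_splits)
      show "z < z'" "z' < t" using e(1) t by (auto simp: z'_def min_def field_simps)
      with * show "f z' < 0" "\<And>s. \<lbrakk>z < s; s \<le> z'\<rbrakk> \<Longrightarrow> f s < 0" by auto
    qed
    \<comment> \<open>The least element \<open>r\<close> of \<open>R\<close> is the first return to
      nonnegative values: \<open>f r = 0\<close> with \<open>f < 0\<close> to its left, which a
      negative derivative at \<open>r\<close> forbids.\<close>
    define R where "R = {z'..t} \<inter> {s. f s \<ge> 0}"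
    have "closed {s. f s \<ge> 0}"
      using cont by (intro closed_Collect_le) auto
    then have "compact R" unfolding R_def by (intro compact_Int_closed) auto
    moreover have "t \<in> R" using nt z' by (auto simp: R_def)
    ultimately obtain r where r: "r \<in> R" "\<And>s. s \<in> R \<Longrightarrow> r \<le> s"
      using compact_attains_inf[of R] by blast
    have neg: "f s < 0" if "z < s" "s < r" for s
      using r(2)[of s] r(1) z'(4)[of s] that by (force simp: R_def)
    have "f r = 0"
    proof (rule ccontr)
      assume "f r \<noteq> 0"
      then have "f r > 0" using r(1) by (auto simp: R_def)
      then obtain w where "z' \<le> w" "w \<le> r" "f w = 0"
        using IVT'[of f z' 0 r] z'(3) r(1) cont' by (force simp: R_def)
      then show False using neg[of w] z' \<open>f r > 0\<close> by (cases "w = r") auto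
    qed
    then obtain d' where "d' < 0" "(f has_real_derivative d') (at r)"
      using der[of r] r(1) z t z' by (auto simp: R_def)
    then obtain e' where e': "e' > 0" "\<And>k. \<lbrakk>0 < k; k < e'\<rbrakk> \<Longrightarrow> f (r - k) > f r"
      using DERIV_neg_dec_left by blast
    have "z < r" using r(1) z' by (simp add: R_def)
    obtain k where k: "0 < k" "k < min e' (r - z)"
      using dense[of 0 "min e' (r - z)"] e'(1) \<open>z < r\<close> by auto
    then have "f (r - k) > 0" using e'(2)[of k] \<open>f r = 0\<close> by simp
    moreover have "f (r - k) < 0" using neg[of "r - k"] k by simp
    ultimately show False by linarith
  qed
  have "f u > 0" using start by auto
  then obtain z where z: "u \<le> z" "z \<le> b" "f z = 0"
    using IVT2'[of f b 0 u] cont' assms by force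
  have "f t > 0" if "a < t" "t < z" for t
  proof (rule ccontr)
    assume n: "\<not> f t > 0"
    with start that have "u < t" by force
    then obtain w where "u \<le> w" "w \<le> t" "f w = 0"
      using IVT2'[of f t 0 u] cont' n \<open>f u > 0\<close> by force
    then show False using after[of w z] z that start by auto
  qed
  then show thesis using that[of z] z start after[of z] by auto
qed

section \<open>The switching curve\<close>

locale two_zone =
  fixes n :: nat and g :: real
  assumes g0: "0 < g" and g1: "13 * g\<^sup>2 < 3"
begin

abbreviation c :: real where "c \<equiv> g\<^sup>2 + 1"

lemma c_pos: "c > 0"
  by (simp add: add_nonneg_pos)

lemma c_neq_0: "c \<noteq> 0"
  using c_pos by (metis less_irrefl)

lemma h_nonneg: "h n g y \<ge> 0"
  using g0 by (auto simp: h_def intro!: mult_nonneg_nonneg divide_nonneg_nonneg)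

lemma h_zero [simp]: "h n g 0 = 0"
  by (simp add: h_def)

lemma cos_odd_pi: "cos (pi * (2 * real m + 1)) = -1"
proof -
  have "cos (pi * real (2 * m + 1)) = -1" by (subst cos_npi2) simp
  then show ?thesis by (simp add: add.commute)
qed

text \<open>The branches agree at 2n + 1, where the cosine is -1, so capping the argument there
  merges them into one formula from which continuity can be read off.\<close>

lemma h_alt: "h n g y = 2 * g / (c * pi) * (1 - cos (pi * min y (2 * real n + 1)))"
  by (auto simp: h_def cos_odd_pi min_def)

lemma continuous_on_h [continuous_intros]:
  fixes f :: "'a::t2_space \<Rightarrow> real"
  assumes "continuous_on S f"
  shows "continuous_on S (\<lambda>x. h n g (f x))"
  unfolding h_alt by (intro continuous_intros continuous_on_min assms)

lemma continuous_on_H: "continuous_on UNIV (H n g)"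
proof -
  have "H n g = (\<lambda>p. p $ 1 - h n g (max (p $ 2) 0))"
    by (auto simp: H_def max_def fun_eq_iff)
  then show ?thesis
    by (simp only:) (intro continuous_on_diff continuous_on_h continuous_on_max continuous_on_const
      continuous_on_component continuous_on_id)
qed

text \<open>The cosine equals 1 exactly at arguments y that are even integers, and past 2n + 1 the
  function is a positive constant, so the zeros stop at 2n. This is where the number n of cycles
  originates.\<close>

lemma h_eq_zero_iff:
  assumes "y > 0"
  shows "h n g y = 0 \<longleftrightarrow> (\<exists>k\<in>{1..n}. y = 2 * real k)"
proof
  assume *: "h n g y = 0"
  have "2 * g / (c * pi) \<noteq> 0" using g0 c_neq_0 by simp
  then have y: "y \<le> 2 * real n + 1" "cos (pi * y) = 1"
    using * by (auto simp: h_def split: if_splits)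
  obtain j :: int where "pi * y = real_of_int j * 2 * pi"
    using cos_one_2pi_int[THEN iffD1, OF y(2)] by (rule exE)
  then have j: "y = 2 * j" by simp
  then have "1 \<le> j" "j \<le> n" using assms y(1) by linarith+
  then show "\<exists>k\<in>{1..n}. y = 2 * real k"
    using j by (intro bexI[of _ "nat j"]) auto
next
  assume "\<exists>k\<in>{1..n}. y = 2 * real k"
  then obtain k where k: "k \<in> {1..n}" "y = 2 * real k" by auto
  have "cos (pi * (2 * real k)) = 1"
    using cos_2npi[of k] by (simp only: mult.commute)
  then show "h n g y = 0" using k by (simp add: h_def)
qed

definition h' :: "real \<Rightarrow> real" where
  "h' y = (if y \<le> 2 * real n + 1 then 2 * g / c * sin (pi * y) else 0)"

text \<open>At 2n + 1 both one-sided slopes are 0, since sin (pi (2n + 1)) = 0. Without a kink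
  there, crossings can be tested by a derivative everywhere on the curve.\<close>

lemma h_has_derivative: "(h n g has_real_derivative h' y) (at y)"
proof -
  let ?m = "2 * real n + 1"
  let ?k = "\<lambda>y. 2 * g / (c * pi) * (1 - cos (pi * y))"
  have k: "(?k has_real_derivative 2 * g / c * sin (pi * y)) (at y within S)" for y S
  proof -
    have "((\<lambda>y. 1 - cos (pi * y)) has_real_derivative sin (pi * y) * pi) (at y within S)"
      by (auto intro!: derivative_eq_intros)
    then have "(?k has_real_derivative 2 * g / (c * pi) * (sin (pi * y) * pi)) (at y within S)"
      by (rule DERIV_cmult)
    moreover have "2 * g / (c * pi) * (sin (pi * y) * pi) = 2 * g / c * sin (pi * y)"
      by (simp add: c_neq_0)
    ultimately show ?thesis by (simp only:)
  qed
  have sm: "sin (pi * ?m) = 0"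
    using sin_npi[of "2 * n + 1"] by (simp add: mult.commute add.commute)
  consider "y < ?m" | "y > ?m" | "y = ?m" by linarith
  then show ?thesis
  proof cases
    case 1
    have "\<forall>\<^sub>F z in nhds y. h n g z = ?k z"
      by (rule eventually_mono[OF eventually_nhds_in_open[of "{..<?m}" y]]) (use 1 in \<open>auto simp: h_def\<close>)
    from DERIV_cong_ev[OF refl this refl, THEN iffD2, OF k] show ?thesis
      using 1 by (simp add: h'_def)
  next
    case 2
    have "\<forall>\<^sub>F z in nhds y. h n g z = 2 * g / (c * pi) * 2"
      by (rule eventually_mono[OF eventually_nhds_in_open[of "{?m<..}" y]]) (use 2 in \<open>auto simp: h_def\<close>)
    from DERIV_cong_ev[OF refl this refl, THEN iffD2, OF DERIV_const] show ?thesis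
      using 2 by (simp add: h'_def)
  next
    case 3
    have "((\<lambda>z. if z \<in> {..?m} then ?k z else 2 * g / (c * pi) * 2) has_vector_derivative
        (if y \<in> {..?m} then 2 * g / c * sin (pi * y) else 0)) (at y within UNIV)"
    proof (rule has_vector_derivative_If_within_closures[where T = "{?m<..}"])
      show "((\<lambda>z. ?k z) has_vector_derivative 2 * g / c * sin (pi * y))
          (at y within {..?m} \<union> closure {..?m} \<inter> closure {?m<..})"
        using k unfolding has_real_derivative_iff_has_vector_derivative by blast
    qed (use 3 sm in \<open>auto simp: cos_odd_pi\<close>)
    moreover have "(\<lambda>z. if z \<in> {..?m} then ?k z else 2 * g / (c * pi) * 2) = h n g"
      by (auto simp: h_def fun_eq_iff)
    ultimately show ?thesis
      using 3 by (simp add: has_real_derivative_iff_has_vector_derivative h'_def)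
  qed
qed

lemma four_g2_div_c: "4 * g\<^sup>2 / c < 3 / 4"
  using g1 c_pos by (simp add: field_simps)

text \<open>For s = g and s = - g the left-hand side is the derivative of x - h(y) along
  \<open>field s\<close> at the point (h y, y), as x' = 2 s x - y and y' = c x. Its sign means that
  both flows pass from H > 0 to H < 0.\<close>

lemma transversal:
  assumes y: "y > 0" and s: "s \<le> g"
  shows "2 * s * h n g y - y - h' y * (c * h n g y) < 0"
proof -
  have "2 * g * h n g y - y - h' y * (c * h n g y) < 0"
  proof (cases "y \<le> 2 * real n + 1")
    case True
    let ?A = "1 - cos (pi * y)" and ?B = "1 - sin (pi * y)"
    have eq: "2 * g * h n g y - h' y * (c * h n g y) = (4 * g\<^sup>2 / c) * (?A * ?B) / pi"
    proof -
      have "h' y * (c * h n g y) = 2 * g * sin (pi * y) * h n g y"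
        using True c_pos by (simp add: h'_def)
      then have "2 * g * h n g y - h' y * (c * h n g y) = 2 * g * h n g y * ?B"
        by (simp add: algebra_simps)
      also have "\<dots> = (4 * g\<^sup>2 / c) * (?A * ?B) / pi"
        using True by (simp add: h_def power2_eq_square)
      finally show ?thesis .
    qed
    have A: "0 \<le> ?A" "?A \<le> 2" and B: "0 \<le> ?B" "?B \<le> 2"
      using sin_ge_minus_one[of "pi * y"] cos_ge_minus_one[of "pi * y"] by auto
    \<comment> \<open>The constant 4 fits since 3/4 * 4 / pi < 1. For y >= 1 each factor is at most
      2. Below 1 the sine is nonnegative, so \<open>?B\<close> is at most 1, and \<open>?A\<close>
      is bounded by 2 or, for y < 1/2, by its quadratic growth.\<close>
    have AB: "?A * ?B \<le> 4 * y"
    proof (cases "y \<ge> 1")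
      case True
      have "?A * ?B \<le> 2 * 2" using A B by (intro mult_mono) auto
      then show ?thesis using True by simp
    next
      case False
      then have "sin (pi * y) \<ge> 0" using y by (intro sin_ge_zero) auto
      then have "?A * ?B \<le> ?A * 1" using A by (intro mult_left_mono) auto
      moreover have "?A \<le> 4 * y"
      proof (cases "y \<ge> 1/2")
        case True
        then show ?thesis using A by linarith
      next
        case False
        have "?A = 2 * (sin (pi * y / 2))\<^sup>2" using cos_double_sin[of "pi * y / 2"] by simp
        also have "\<dots> \<le> 2 * (pi * y / 2)\<^sup>2"
          using abs_sin_x_le_abs_x[of "pi * y / 2"] abs_le_square_iff[of "sin (pi*y/2)" "pi*y/2"] by simp
        also have "\<dots> = (pi * pi * y / 2) * y" by (simp add: power2_eq_square)
        also have "\<dots> \<le> 4 * y"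
        proof (rule mult_right_mono)
          have "pi * pi * y \<le> 4 * 4 * (1/2)"
            using pi_less_4 pi_gt_zero False y by (intro mult_mono) auto
          then show "pi * pi * y / 2 \<le> 4" by simp
        qed (use y in auto)
        finally show ?thesis .
      qed
      ultimately show ?thesis by simp
    qed
    have "(4 * g\<^sup>2 / c) * (?A * ?B) / pi \<le> (3/4) * (4 * y) / pi"
      using four_g2_div_c AB mult_nonneg_nonneg[OF A(1) B(1)]
      by (intro divide_right_mono mult_mono[of "4 * g\<^sup>2 / c" "3/4" "?A * ?B" "4 * y"]) auto
    also have "\<dots> < y" using pi_gt3 y by (simp add: field_simps)
    finally show ?thesis using eq by simp
  next
    case False
    then have "y > 1" by simp
    have "2 * g * h n g y = 2 * (4 * g\<^sup>2 / c) / pi"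
      using False c_pos by (simp add: h_def field_simps power2_eq_square)
    also have "\<dots> \<le> 2 * (3/4) / pi" using four_g2_div_c by (intro divide_right_mono) auto
    also have "\<dots> < 1" using pi_gt3 by simp
    finally show ?thesis using False by (simp add: h'_def)
  qed
  \<comment> \<open>As \<open>h\<close> is nonnegative, s = g is the worst case.\<close>
  moreover have "2 * s * h n g y \<le> 2 * g * h n g y"
    using s h_nonneg by (intro mult_right_mono) auto
  ultimately show ?thesis by linarith
qed

section \<open>The two linear flows\<close>

text \<open>\<open>E s\<close> is the orbit of the flow of \<^term>\<open>field s\<close> through \<open>(0, - 1)\<close>; the matrices \<open>G\<^sup>+\<close> and
  \<open>G\<^sup>-\<close> correspond to \<open>s = g\<close> and \<open>s = - g\<close>.\<close>
definition E :: "real \<Rightarrow> real \<Rightarrow> real^2" where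
  "E s t = vector [exp (s * t) * sin t, exp (s * t) * (s * sin t - cos t)]"

definition field :: "real \<Rightarrow> real^2 \<Rightarrow> real^2" where
  "field s p = vector [2 * s * p $ 1 - p $ 2, (s\<^sup>2 + 1) * p $ 1]"

lemma E_nth [simp]:
  "E s t $ 1 = exp (s * t) * sin t" "E s t $ 2 = exp (s * t) * (s * sin t - cos t)"
  by (simp_all add: E_def)

lemma field_nth [simp]:
  "field s p $ 1 = 2 * s * p $ 1 - p $ 2" "field s p $ 2 = (s\<^sup>2 + 1) * p $ 1"
  by (simp_all add: field_def)

lemma pw_field_eq: "pw_field n g p = field (if H n g p < 0 then - g else g) p"
  by (simp add: pw_field_def G_minus_def G_plus_def vec_eq_iff forall_2 matrix_vector_mult_def
      sum_2)

lemma E_has_derivative: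
  "((\<lambda>t. a *\<^sub>R E s (t - b)) has_vector_derivative field s (a *\<^sub>R E s (t - b))) (at t)"
  unfolding has_vector_derivative_vec2_iff
  by (auto intro!: derivative_eq_intros simp: algebra_simps power2_eq_square)

lemma continuous_on_E [continuous_intros]:
  fixes f :: "'a::t2_space \<Rightarrow> real"
  assumes "continuous_on S f"
  shows "continuous_on S (\<lambda>x. E s (f x))"
  unfolding E_def by (intro continuous_intros assms)

text \<open>The orbit runs through x > 0 during (0, pi) and meets the upper y-axis at time pi, where
  H = - h <= 0. So it reaches the switching curve by then, and transversality makes the crossing
  unique. The value z = pi occurs when \<open>h\<close> vanishes at the top point. After pi, x < 0
  forces H < 0.\<close>

lemma crossing_time:
  assumes a: "a > 0" and s: "s = g \<or> s = - g"
  obtains z where "0 < z" "z \<le> pi" "H n g (a *\<^sub>R E s z) = 0" "(a *\<^sub>R E s z) $ 2 > 0"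
    "\<And>t. \<lbrakk>0 < t; t < z\<rbrakk> \<Longrightarrow> H n g (a *\<^sub>R E s t) > 0"
    "\<And>t. \<lbrakk>z < t; t < 2 * pi\<rbrakk> \<Longrightarrow> H n g (a *\<^sub>R E s t) < 0"
proof -
  define f where "f t = H n g (a *\<^sub>R E s t)" for t
  have s2: "s\<^sup>2 + 1 = c" "s \<le> g" using s g0 by auto
  have cont: "continuous_on UNIV f"
    unfolding f_def
    by (rule continuous_on_compose2[OF continuous_on_H]) (auto intro!: continuous_intros)
  have x_pos: "(a *\<^sub>R E s t) $ 1 > 0" if "0 < t" "t < pi" for t
    using a that by (simp add: sin_gt_zero)
  have y_pi: "(a *\<^sub>R E s pi) $ 2 > 0" using a by simp
  have y_pos: "(a *\<^sub>R E s t) $ 2 > 0" if "0 < t" "t \<le> pi" "f t \<le> 0" for t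
  proof (cases "t = pi")
    case False
    then show ?thesis using that x_pos[of t] by (auto simp: f_def H_def split: if_splits)
  qed (use y_pi in auto)
  have der: "\<exists>d<0. (f has_real_derivative d) (at t)" if t: "0 < t" "t \<le> pi" "f t = 0" for t
  proof -
    let ?x = "\<lambda>t. (a *\<^sub>R E s t) $ 1" and ?y = "\<lambda>t. (a *\<^sub>R E s t) $ 2"
    have y: "?y t > 0" using y_pos[of t] t by linarith
    note D' = E_has_derivative[of a s 0 t, unfolded has_vector_derivative_vec2_iff field_nth s2(1) diff_zero]
    note D = conjunct1[OF D'] conjunct2[OF D']
    have "continuous_on UNIV ?y" by (intro continuous_intros)
    then have "open {r. ?y r > 0}" by (intro open_Collect_less) auto
    then have ev: "\<forall>\<^sub>F r in nhds t. f r = ?x r - h n g (?y r)"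
      by (rule eventually_mono[OF eventually_nhds_in_open[of "{r. ?y r > 0}" t]])
         (use y in \<open>auto simp: f_def H_def\<close>)
    have "((\<lambda>r. ?x r - h n g (?y r)) has_real_derivative
        (2 * s * ?x t - ?y t) - h' (?y t) * (c * ?x t)) (at t)"
      by (rule DERIV_diff[OF D(1) DERIV_chain2[OF h_has_derivative D(2)]])
    then have "(f has_real_derivative (2 * s * ?x t - ?y t) - h' (?y t) * (c * ?x t)) (at t)"
      by (rule DERIV_cong_ev[OF refl ev refl, THEN iffD2])
    moreover have "?x t = h n g (?y t)" using y t(3) by (simp add: f_def H_def)
    ultimately show ?thesis
      using transversal[OF y s2(2)] by (intro exI conjI) simp_all
  qed
  \<comment> \<open>H vanishes at time 0, so positivity can only be claimed afterwards: as long as y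
    < 0, H is just x.\<close>
  obtain u where u: "0 < u" "u < pi" "\<And>t. \<lbrakk>0 < t; t \<le> u\<rbrakk> \<Longrightarrow> f t > 0"
  proof -
    have "continuous_on UNIV (\<lambda>t. (a *\<^sub>R E s t) $ 2)" by (intro continuous_intros)
    then have "open {t. (a *\<^sub>R E s t) $ 2 < 0}" by (intro open_Collect_less) auto
    moreover have "0 \<in> {t. (a *\<^sub>R E s t) $ 2 < 0}" using a by simp
    ultimately obtain e where e: "e > 0" "ball 0 e \<subseteq> {t. (a *\<^sub>R E s t) $ 2 < 0}"
      by (rule openE)
    let ?u = "min (e/2) (pi/2)"
    have "f t > 0" if "0 < t" "t \<le> ?u" for t
    proof -
      have "t \<in> ball 0 e" "t < pi" using that e(1) pi_gt_zero by (auto simp: dist_real_def)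
      then have "(a *\<^sub>R E s t) $ 2 < 0" using e(2) by blast
      then show ?thesis using x_pos[of t] that(1) \<open>t < pi\<close> by (simp add: f_def H_def)
    qed
    with e(1) pi_gt_zero show thesis by (intro that[of ?u]) (simp_all add: min_less_iff_disj)
  qed
  have "f pi \<le> 0" using y_pi h_nonneg by (simp add: f_def H_def)
  then obtain z where z: "0 < z" "z \<le> pi" "f z = 0"
      "\<And>t. \<lbrakk>0 < t; t < z\<rbrakk> \<Longrightarrow> f t > 0" "\<And>t. \<lbrakk>z < t; t \<le> pi\<rbrakk> \<Longrightarrow> f t < 0"
    using sign_change_unique[OF cont der u] by blast
  have "f t < 0" if "pi < t" "t < 2 * pi" for t
  proof -
    have "(a *\<^sub>R E s t) $ 1 < 0" using a that by (simp add: sin_lt_zero mult_pos_neg)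
    then show ?thesis using h_nonneg[of "(a *\<^sub>R E s t) $ 2"] by (auto simp: f_def H_def)
  qed
  then have neg: "f t < 0" if "z < t" "t < 2 * pi" for t
    using z(5)[of t] that by (cases "t \<le> pi") auto
  have "(a *\<^sub>R E s z) $ 2 > 0" using y_pos[of z] z(1-3) by linarith
  then show thesis
    using that[of z] z(1-4) neg unfolding f_def by blast
qed

end

section \<open>Isolated zeros, first zeros and continuous logarithms\<close>

lemma finite_isolated_Int_interval:
  fixes Z :: "real set"
  assumes "closed Z" and iso: "\<And>t. \<lbrakk>t \<in> Z; t \<in> {a..b}\<rbrakk> \<Longrightarrow> \<not> t islimpt Z"
  shows "finite (Z \<inter> {a..b})"
proof (rule ccontr)
  assume "infinite (Z \<inter> {a..b})"
  then obtain t where t: "t \<in> {a..b}" "t islimpt (Z \<inter> {a..b})"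
    using Heine_Borel_imp_Bolzano_Weierstrass[of "{a..b}" "Z \<inter> {a..b}"] by auto
  then have "t islimpt Z" by (meson inf_le1 islimpt_subset)
  then show False using iso t(1) \<open>closed Z\<close> closed_limpt by blast
qed

lemma crosses_not_islimpt:
  assumes "crosses \<phi> t"
  shows "\<not> t islimpt {s. \<phi> s = 0}"
proof -
  obtain e where e: "e > 0" "\<And>s. \<lbrakk>t - e < s; s < t + e; s \<noteq> t\<rbrakk> \<Longrightarrow> \<phi> s \<noteq> 0"
  proof -
    obtain e where "e > 0" "((\<forall>s\<in>{t-e<..<t}. \<phi> s < 0) \<and> (\<forall>s\<in>{t<..<t+e}. \<phi> s > 0)) \<or>
     ((\<forall>s\<in>{t-e<..<t}. \<phi> s > 0) \<and> (\<forall>s\<in>{t<..<t+e}. \<phi> s < 0))"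
      using assms unfolding crosses_def by auto
    then show thesis
      by (intro that[of e])
         (auto, (metis greaterThanLessThan_iff less_irrefl linorder_neqE_linordered_idom)+)
  qed
  then show ?thesis
    unfolding islimpt_approachable
    by (force simp: dist_real_def intro!: exI[of _ e])
qed

text \<open>At a first zero \<open>b\<close> the estimate on [s, r] with r < b passes to the limit
  and keeps \<open>q b\<close> above a positive number. The estimate is asked for only where
  \<open>q\<close> is positive, since for solutions it rests on the finiteness of crossings away
  from the origin.\<close>

lemma stays_positive:
  fixes q :: "real \<Rightarrow> real"
  assumes cont: "continuous_on UNIV q" and "q s > 0" "s \<le> t"
    and bd: "\<And>a b. \<lbrakk>a \<le> b; \<And>r. r \<in> {a..b} \<Longrightarrow> q r > 0\<rbrakk> \<Longrightarrow> q a * exp (- M * (b - a)) \<le> q b"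
  shows "q t > 0"
proof (rule ccontr)
  assume n: "\<not> q t > 0"
  define R where "R = {s..t} \<inter> {r. q r \<le> 0}"
  have "closed {r. q r \<le> 0}" using cont by (intro closed_Collect_le) auto
  then have "compact R" unfolding R_def by (intro compact_Int_closed) auto
  moreover have "t \<in> R" using n assms(3) by (simp add: R_def)
  ultimately obtain b where b: "b \<in> R" "\<And>r. r \<in> R \<Longrightarrow> b \<le> r"
    using compact_attains_inf[of R] by blast
  have "s < b" using b(1) assms(2) by (cases "s = b") (auto simp: R_def)
  have pos: "q r > 0" if "s \<le> r" "r < b" for r
    using b(2)[of r] b(1) that by (force simp: R_def)
  have "\<forall>\<^sub>F r in at_left b. q s * exp (- M * (r - s)) \<le> q r"
    unfolding eventually_at_left_field using \<open>s < b\<close> bd[of s] pos by force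
  moreover have "(q \<longlongrightarrow> q b) (at_left b)"
    using cont by (meson UNIV_I continuous_on_def subset_UNIV tendsto_within_subset)
  moreover have "((\<lambda>r. q s * exp (- M * (r - s))) \<longlongrightarrow> q s * exp (- M * (b - s))) (at_left b)"
    by (intro tendsto_intros)
  ultimately have "q s * exp (- M * (b - s)) \<le> q b"
    by (intro tendsto_le[of "at_left b"]) auto
  moreover have "q s * exp (- M * (b - s)) > 0" using assms(2) by simp
  ultimately show False using b(1) by (simp add: R_def)
qed

text \<open>Near \<open>t\<close> the increment of \<open>L\<close> stays in the strip on which
  \<open>Ln\<close> inverts \<open>exp\<close>, so a continuous logarithm inherits differentiability
  from its exponential.\<close>

lemma has_vector_derivative_of_continuous_log:
  fixes L :: "real \<Rightarrow> complex"
  assumes "isCont L t" and F: "((\<lambda>s. exp (L s)) has_vector_derivative D) (at t)"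
  shows "(L has_vector_derivative D / exp (L t)) (at t)"
proof -
  let ?G = "\<lambda>s. L t + Ln (exp (L s) / exp (L t))"
  have "((\<lambda>s. exp (L s) / exp (L t)) has_vector_derivative D / exp (L t)) (at t)"
    using has_vector_derivative_mult_left[OF F, of "inverse (exp (L t))"] by (simp add: field_simps)
  moreover have "(Ln has_field_derivative inverse 1) (at (exp (L t) / exp (L t)))"
    using has_field_derivative_Ln[of 1] by simp
  ultimately have "((Ln \<circ> (\<lambda>s. exp (L s) / exp (L t))) has_vector_derivative D / exp (L t) * inverse 1) (at t)"
    by (rule field_vector_diff_chain_at)
  then have G: "(?G has_vector_derivative D / exp (L t)) (at t)"
    using has_vector_derivative_add[OF has_vector_derivative_const[of "L t"]] by (simp add: o_def)
  have "\<forall>\<^sub>F s in nhds t. dist (L s) (L t) < pi"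
    using assms(1) pi_gt_zero by (simp add: isCont_def tendsto_at_iff_tendsto_nhds tendstoD)
  then obtain S where S: "open S" "t \<in> S" "\<And>s. s \<in> S \<Longrightarrow> dist (L s) (L t) < pi"
    unfolding eventually_nhds by auto
  have "?G s = L s" if "s \<in> S" for s
  proof -
    have "\<bar>Im (L s - L t)\<bar> < pi"
      using S(3)[OF that] abs_Im_le_cmod[of "L s - L t"] by (simp add: dist_norm)
    then have "Ln (exp (L s - L t)) = L s - L t" by (intro Ln_exp) auto
    then show ?thesis by (simp add: exp_diff)
  qed
  with has_vector_derivative_transform_within_open[OF G S(1,2)] show ?thesis by simp
qed

lemma DERIV_abs:
  assumes "x \<noteq> (0::real)"
  shows "(abs has_real_derivative sgn x) (at x)"
proof (cases "x > 0")
  case True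
  have "\<forall>\<^sub>F z in nhds x. \<bar>z\<bar> = z"
    by (rule eventually_mono[OF eventually_nhds_in_open[of "{0<..}" x]]) (use True in auto)
  from DERIV_cong_ev[OF refl this refl, THEN iffD2, OF DERIV_ident] show ?thesis using True by simp
next
  case False
  have "\<forall>\<^sub>F z in nhds x. \<bar>z\<bar> = - z"
    by (rule eventually_mono[OF eventually_nhds_in_open[of "{..<0}" x]]) (use False assms in auto)
  from DERIV_cong_ev[OF refl this refl, THEN iffD2, OF DERIV_minus[OF DERIV_ident]] show ?thesis
    using False assms by simp
qed

lemma DERIV_arccos_cos:
  assumes "sin t \<noteq> 0"
  shows "((\<lambda>t. arccos (cos t)) has_real_derivative sgn (sin t)) (at t)"
proof -
  have "\<bar>cos t\<bar> \<noteq> 1"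
    using assms sin_cos_squared_add[of t] by (metis add_cancel_left_left power2_abs power_one power_zero_numeral zero_eq_power2)
  then have "-1 < cos t" "cos t < 1"
    using cos_le_one[of t] cos_ge_minus_one[of t] by linarith+
  moreover have "sqrt (1 - (cos t)\<^sup>2) = \<bar>sin t\<bar>"
    by (simp add: sin_squared_eq[symmetric])
  ultimately show ?thesis
    using assms by (auto intro!: derivative_eq_intros simp: sgn_if divide_simps abs_if)
qed

context two_zone
begin

section \<open>Polar coordinates adapted to the unswitched centre\<close>

text \<open>In the coordinate \<open>W\<close> the flow of \<open>G\<^sup>+\<close> in \<open>x > 0\<close> is multiplication by \<open>exp ((g + \<i>) t)\<close> and that of
  \<open>G\<^sup>-\<close> in \<open>x < 0\<close> is multiplication by \<open>exp ((- g + \<i>) t)\<close>.\<close>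
definition W :: "real^2 \<Rightarrow> complex" where
  "W p = Complex (g * \<bar>p $ 1\<bar> - p $ 2) (p $ 1)"

definition V :: "complex \<Rightarrow> real^2" where
  "V z = vector [Im z, g * \<bar>Im z\<bar> - Re z]"

lemma W_simps [simp]: "Re (W p) = g * \<bar>p $ 1\<bar> - p $ 2" "Im (W p) = p $ 1"
  by (simp_all add: W_def)

lemma V_simps [simp]: "V z $ 1 = Im z" "V z $ 2 = g * \<bar>Im z\<bar> - Re z"
  by (simp_all add: V_def)

lemma W_V [simp]: "W (V z) = z" and V_W [simp]: "V (W p) = p"
  by (simp_all add: complex_eq_iff vec_eq_iff forall_2)

lemma W_eq_0_iff [simp]: "W p = 0 \<longleftrightarrow> p = 0"
  by (auto simp: complex_eq_iff vec_eq_iff forall_2)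

lemma W_inj: "W p = W q \<Longrightarrow> p = q"
  by (metis V_W)

lemma continuous_on_W: "continuous_on S W"
  unfolding W_def by (subst Complex_eq) (intro continuous_intros)

lemma continuous_on_V [continuous_intros]:
  "continuous_on S f \<Longrightarrow> continuous_on S (\<lambda>x. V (f x))"
  unfolding V_def by (intro continuous_intros)

lemma W_scaleR: "l \<ge> 0 \<Longrightarrow> W (l *\<^sub>R p) = of_real l * W p"
  by (simp add: complex_eq_iff abs_mult algebra_simps)

lemma W_E_right:
  assumes "a \<ge> 0" "sin t \<ge> 0"
  shows "W (a *\<^sub>R E g t) = of_real (a * exp (g * t)) * cis t"
  using assms by (simp add: complex_eq_iff abs_mult algebra_simps)

lemma norm_le_W: "norm p \<le> (2 + g) * cmod (W p)"
proof -
  have "norm p \<le> \<bar>p $ 1\<bar> + \<bar>p $ 2\<bar>"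
    using norm_le_l1_cart[of p] by (simp add: sum_2)
  also have "\<dots> \<le> \<bar>Im (W p)\<bar> + (g * \<bar>Im (W p)\<bar> + \<bar>Re (W p)\<bar>)"
    using mult_nonneg_nonneg[of g "\<bar>p $ 1\<bar>"] g0 unfolding W_simps by linarith
  also have "\<dots> \<le> cmod (W p) + (g * cmod (W p) + cmod (W p))"
    using g0 abs_Im_le_cmod[of "W p"] abs_Re_le_cmod[of "W p"] by (intro add_mono mult_left_mono) auto
  finally show ?thesis by (simp add: algebra_simps)
qed

lemma polar_form:
  assumes "p \<noteq> 0"
  obtains r t where "r > 0" "0 \<le> t" "t < 2 * pi" "W p = of_real r * cis t"
  by (rule that[of "cmod (W p)" "Arg2pi (W p)"])
     (use assms Arg2pi[of "W p"] in \<open>auto simp: cis_conv_exp is_Arg_def simp del: W_simps\<close>)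

text \<open>As \<open>arccos (cos t)\<close> rises with slope 1 on \<open>[0, \<pi>]\<close> and falls back on \<open>[\<pi>, 2\<pi>]\<close>, this is a first
  integral of both linear flows, each in its half-plane.\<close>
definition N :: "real^2 \<Rightarrow> real" where
  "N p = cmod (W p) * exp (- g * arccos (Re (W p) / cmod (W p)))"

lemma N_polar:
  assumes "r > 0" "W p = of_real r * cis t"
  shows "N p = r * exp (- g * arccos (cos t))"
  using assms by (simp add: N_def norm_mult del: W_simps)

lemma N_pos_iff: "N p > 0 \<longleftrightarrow> p \<noteq> 0"
  by (simp add: N_def zero_less_mult_iff del: W_simps)

lemma N_0 [simp]: "N 0 = 0" and N_nonneg: "N p \<ge> 0"
  by (simp_all add: N_def)

lemma N_scaleR:
  assumes "l \<ge> 0"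
  shows "N (l *\<^sub>R p) = l * N p"
  using assms by (cases "l = 0") (simp_all add: N_def W_scaleR norm_mult del: W_simps)

lemma Re_div_cmod: "- 1 \<le> Re z / cmod z" "Re z / cmod z \<le> 1"
  using abs_Re_le_cmod[of z] by (cases "z = 0"; simp add: divide_simps abs_le_iff)+

text \<open>The angle in \<open>N\<close> lies in [0, pi], so its exponential factor is at least exp
  (- g pi).\<close>

lemma cmod_W_le_N: "cmod (W p) \<le> exp (g * pi) * N p"
proof -
  let ?b = "arccos (Re (W p) / cmod (W p))"
  have "?b \<le> pi" using arccos_ubound Re_div_cmod by blast
  then have "1 \<le> exp (g * pi) * exp (- g * ?b)"
    using g0 by (simp add: exp_add[symmetric] algebra_simps)
  then have "cmod (W p) * 1 \<le> cmod (W p) * (exp (g * pi) * exp (- g * ?b))"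
    by (intro mult_left_mono) auto
  then show ?thesis by (simp add: N_def algebra_simps del: W_simps)
qed

lemma norm_le_N: "norm p \<le> (2 + g) * exp (g * pi) * N p"
proof -
  have "(2 + g) * cmod (W p) \<le> (2 + g) * (exp (g * pi) * N p)"
    using cmod_W_le_N g0 by (intro mult_left_mono) auto
  then show ?thesis using norm_le_W[of p] by (simp add: mult.assoc)
qed

lemma N_le_cmod_W: "N p \<le> cmod (W p)"
proof -
  have "arccos (Re (W p) / cmod (W p)) \<ge> 0"
    using arccos_lbound Re_div_cmod by blast
  then have "exp (- g * arccos (Re (W p) / cmod (W p))) \<le> 1" using g0 by simp
  then show ?thesis unfolding N_def by (intro mult_left_le) auto
qed

lemma continuous_on_N: "continuous_on UNIV N"
proof -
  have "isCont N p" for p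
  proof (cases "p = 0")
    case False
    have "continuous_on (- {0}) N"
      unfolding N_def
      by (intro continuous_intros continuous_on_W continuous_on_arccos)
         (auto simp del: W_simps simp: Re_div_cmod)
    moreover have "open (- {0 :: real^2})" by (simp add: open_Compl)
    ultimately show ?thesis using False by (auto simp: continuous_on_eq_continuous_at)
  next
    \<comment> \<open>The quotient in \<open>N\<close> has no limit at the origin, so continuity
      comes from squeezing \<open>N\<close> between 0 and \<open>cmod (W p)\<close>.\<close>
    case True
    have "((\<lambda>p. cmod (W p)) \<longlongrightarrow> cmod (W 0)) (at 0)"
      using continuous_on_norm[OF continuous_on_W[of UNIV]] by (simp add: continuous_on_def)
    moreover have "W 0 = 0" by simp
    ultimately have "(N \<longlongrightarrow> 0) (at 0)"
      by (intro tendsto_sandwich[of "\<lambda>_. 0" N _ "\<lambda>p. cmod (W p)"])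
         (auto simp: N_nonneg N_le_cmod_W del: W_simps)
    then show ?thesis using True by (simp add: isCont_def)
  qed
  then show ?thesis by (simp add: continuous_at_imp_continuous_on)
qed


section \<open>Monotonicity along arbitrary solutions\<close>

context
  fixes X :: "real \<Rightarrow> real^2"
  assumes sol: "pw_solution n g X"
begin

lemma sol_continuous: "continuous_on S X"
  using sol continuous_on_subset unfolding pw_solution_def by blast

lemma sol_continuous_H: "continuous_on S (\<lambda>t. H n g (X t))"
  by (rule continuous_on_compose2[OF continuous_on_H sol_continuous]) auto

lemma sol_derivative:
  assumes "H n g (X t) \<noteq> 0"
  shows "((\<lambda>t. X t $ 1) has_real_derivative
      2 * (if H n g (X t) < 0 then - g else g) * X t $ 1 - X t $ 2) (at t)"
    "((\<lambda>t. X t $ 2) has_real_derivative c * X t $ 1) (at t)"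
proof -
  have "(X has_vector_derivative field (if H n g (X t) < 0 then - g else g) (X t)) (at t)"
    using sol assms by (simp add: pw_solution_def pw_field_eq)
  from this[unfolded has_vector_derivative_vec2_iff field_nth]
  show "((\<lambda>t. X t $ 1) has_real_derivative
      2 * (if H n g (X t) < 0 then - g else g) * X t $ 1 - X t $ 2) (at t)"
    "((\<lambda>t. X t $ 2) has_real_derivative c * X t $ 1) (at t)"
    by (simp_all split: if_splits)
qed

text \<open>A crossing has strict signs on both sides and is thus an isolated zero of H. At the
  origin a solution obeys the equation instead of crossing, hence the condition that X avoids
  it.\<close>

lemma sol_finite_crossings:
  assumes "\<And>t. t \<in> {a..b} \<Longrightarrow> X t \<noteq> 0"
  shows "finite ({t. H n g (X t) = 0} \<inter> {a..b})"
proof (rule finite_isolated_Int_interval)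
  show "closed {t. H n g (X t) = 0}"
    using sol_continuous_H by (intro closed_Collect_eq) auto
  show "\<not> t islimpt {t. H n g (X t) = 0}" if "t \<in> {t. H n g (X t) = 0}" "t \<in> {a..b}" for t
    using sol assms[of t] that unfolding pw_solution_def
    by (intro crosses_not_islimpt[of "\<lambda>t. H n g (X t)"]) auto
qed

text \<open>Here \<open>q\<close> is the squared norm. Both fields give |q'| <= M q: the diagonal
  entry contributes at most 4 g x^2, the off-diagonal ones g^2 * 2 x y. So q exp (M t) is
  nondecreasing and q exp (- M t) nonincreasing.\<close>

lemma sol_growth_bound:
  assumes ab: "a \<le> b" and nz: "\<And>t. t \<in> {a..b} \<Longrightarrow> X t \<noteq> 0"
  defines "q \<equiv> \<lambda>t. (X t $ 1)\<^sup>2 + (X t $ 2)\<^sup>2" and "M \<equiv> 4 * g + g\<^sup>2"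
  shows "q a * exp (- M * (b - a)) \<le> q b" "q b * exp (- M * (b - a)) \<le> q a"
proof -
  have "\<exists>d. (q has_real_derivative d) (at t) \<and> \<bar>d\<bar> \<le> M * q t" if t: "H n g (X t) \<noteq> 0" for t
  proof -
    define s where "s = (if H n g (X t) < 0 then - g else g)"
    let ?x = "X t $ 1" and ?y = "X t $ 2"
    have s: "\<bar>s\<bar> = g" using g0 by (simp add: s_def)
    have "(q has_real_derivative 2 * ?x * (2 * s * ?x - ?y) + 2 * ?y * (c * ?x)) (at t)"
      unfolding q_def s_def
      by (rule derivative_eq_intros sol_derivative[OF t] refl | simp)+
    moreover have "2 * ?x * (2 * s * ?x - ?y) + 2 * ?y * (c * ?x) = 4 * s * ?x\<^sup>2 + g\<^sup>2 * (2 * ?x * ?y)"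
      by (simp add: algebra_simps power2_eq_square)
    moreover have "\<bar>4 * s * ?x\<^sup>2 + g\<^sup>2 * (2 * ?x * ?y)\<bar> \<le> M * q t"
    proof -
      have "\<bar>2 * ?x * ?y\<bar> \<le> ?x\<^sup>2 + ?y\<^sup>2"
        using sum_squares_bound[of ?x ?y] sum_squares_bound[of ?x "- ?y"] by (simp add: abs_le_iff)
      then have "\<bar>g\<^sup>2 * (2 * ?x * ?y)\<bar> \<le> g\<^sup>2 * q t"
        unfolding abs_mult[of "g\<^sup>2"] q_def by (simp add: mult_left_mono)
      moreover have "\<bar>4 * s * ?x\<^sup>2\<bar> \<le> 4 * g * q t"
        using s g0 by (simp add: abs_mult q_def)
      ultimately show ?thesis by (simp add: M_def algebra_simps)
    qed
    ultimately show ?thesis by metis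
  qed
  then obtain q' where q': "\<And>t. H n g (X t) \<noteq> 0 \<Longrightarrow> (q has_real_derivative q' t) (at t)"
      "\<And>t. H n g (X t) \<noteq> 0 \<Longrightarrow> \<bar>q' t\<bar> \<le> M * q t" by metis
  have q_cont: "continuous_on S q" for S
    unfolding q_def by (intro continuous_intros sol_continuous)
  note fin = sol_finite_crossings[OF nz]
  have "- (q b * exp (M * b)) \<le> - (q a * exp (M * a))"
  proof (rule nonincreasing_if_deriv_nonpos_finite[OF ab _ fin])
    fix t assume "a < t" "t < b" "t \<notin> {t. H n g (X t) = 0} \<inter> {a..b}"
    then have t: "H n g (X t) \<noteq> 0" by auto
    have "((\<lambda>t. - (q t * exp (M * t))) has_real_derivative - (q' t + M * q t) * exp (M * t)) (at t)"
      by (rule derivative_eq_intros q'(1)[OF t] refl | simp add: algebra_simps)+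
    moreover have "- (q' t + M * q t) * exp (M * t) \<le> 0"
      using q'(2)[OF t] by (intro mult_nonpos_nonneg) auto
    ultimately show "\<exists>d\<le>0. ((\<lambda>t. - (q t * exp (M * t))) has_real_derivative d) (at t)" by blast
  qed (intro continuous_intros q_cont)
  then have "q a * exp (M * a) * exp (- M * b) \<le> q b * exp (M * b) * exp (- M * b)"
    by (intro mult_right_mono) auto
  then show "q a * exp (- M * (b - a)) \<le> q b"
    by (simp add: mult.assoc exp_add[symmetric] algebra_simps)
  have "q b * exp (- M * b) \<le> q a * exp (- M * a)"
  proof (rule nonincreasing_if_deriv_nonpos_finite[OF ab _ fin])
    fix t assume "a < t" "t < b" "t \<notin> {t. H n g (X t) = 0} \<inter> {a..b}"
    then have t: "H n g (X t) \<noteq> 0" by auto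
    have "((\<lambda>t. q t * exp (- M * t)) has_real_derivative (q' t - M * q t) * exp (- M * t)) (at t)"
      by (rule derivative_eq_intros q'(1)[OF t] refl | simp add: algebra_simps)+
    moreover have "(q' t - M * q t) * exp (- M * t) \<le> 0"
      using q'(2)[OF t] by (intro mult_nonpos_nonneg) auto
    ultimately show "\<exists>d\<le>0. ((\<lambda>t. q t * exp (- M * t)) has_real_derivative d) (at t)" by blast
  qed (intro continuous_intros q_cont)
  then have "q b * exp (- M * b) * exp (M * a) \<le> q a * exp (- M * a) * exp (M * a)"
    by (intro mult_right_mono) auto
  then show "q b * exp (- M * (b - a)) \<le> q a"
    by (simp add: mult.assoc exp_add[symmetric] algebra_simps)
qed

text \<open>By the exponential bounds, used forwards and, after reversing time, backwards, the
  origin cannot be reached in finite time.\<close>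

lemma sol_nonzero:
  assumes "X s \<noteq> 0"
  shows "X t \<noteq> 0"
proof -
  define q where "q t = (X t $ 1)\<^sup>2 + (X t $ 2)\<^sup>2" for t
  have q_pos: "q t > 0 \<longleftrightarrow> X t \<noteq> 0" for t
    by (auto simp: q_def vec_eq_iff forall_2 sum_power2_gt_zero_iff)
  have q_cont: "continuous_on S q" for S
    unfolding q_def by (intro continuous_intros sol_continuous)
  have "q t > 0"
  proof (cases "s \<le> t")
    case True
    show ?thesis
      by (rule stays_positive[OF q_cont _ True, where M = "4 * g + g\<^sup>2"])
         (use assms sol_growth_bound(1) q_pos in \<open>auto simp: q_def\<close>)
  next
    case False
    have "q (- (- t)) > 0"
    proof (rule stays_positive[where q = "\<lambda>t. q (- t)" and s = "- s" and M = "4 * g + g\<^sup>2"])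
      show "continuous_on UNIV (\<lambda>t. q (- t))"
        by (rule continuous_on_compose2[OF q_cont]) (auto intro!: continuous_intros)
      fix a b :: real assume ab: "a \<le> b" "\<And>r. r \<in> {a..b} \<Longrightarrow> q (- r) > 0"
      have "X r \<noteq> 0" if "r \<in> {- b..- a}" for r
        using ab(2)[of "- r"] that q_pos[of r] by auto
      then show "q (- a) * exp (- (4 * g + g\<^sup>2) * (b - a)) \<le> q (- b)"
        using sol_growth_bound(2)[of "- b" "- a"] ab(1) by (simp add: q_def)
    qed (use assms False q_pos in auto)
    then show ?thesis by simp
  qed
  then show ?thesis using q_pos by simp
qed

text \<open>On the y-axis both fields have x' = - y, so near such a point x is strictly monotone
  whichever field acts. The slope is at least \<open>k\<close> in absolute value, with sign opposite
  to \<open>v\<close>, the sign of y.\<close>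

lemma sol_x_zero_not_islimpt:
  assumes nz: "X t \<noteq> 0" and x0: "X t $ 1 = 0"
  shows "\<not> t islimpt {s. X s $ 1 = 0}"
proof -
  define v where "v = sgn (X t $ 2)"
  define k where "k = \<bar>X t $ 2\<bar> / 2"
  let ?r = "\<lambda>s. 2 * g * \<bar>X s $ 1\<bar> - v * X s $ 2"
  have y: "X t $ 2 \<noteq> 0" using nz x0 by (auto simp: vec_eq_iff forall_2)
  then have k: "k > 0" "?r t < - k" and v: "\<bar>v\<bar> = 1"
    using x0 by (auto simp: k_def v_def sgn_if)
  have "continuous_on UNIV ?r" by (intro continuous_intros sol_continuous)
  then have "open {s. ?r s < - k}" by (intro open_Collect_less) auto
  then obtain e where e: "e > 0" "ball t e \<subseteq> {s. ?r s < - k}" using k(2) by (auto elim: openE)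
  have mono: "v * X b $ 1 + k * b \<le> v * X a $ 1 + k * a"
    if ab: "a \<le> b" "a \<in> ball t e" "b \<in> ball t e" for a b
  proof (rule nonincreasing_if_deriv_nonpos_finite[OF ab(1) _ sol_finite_crossings[of a b]])
    show "X s \<noteq> 0" for s using sol_nonzero[OF nz] .
    fix s assume s: "a < s" "s < b" "s \<notin> {t. H n g (X t) = 0} \<inter> {a..b}"
    then have Hs: "H n g (X s) \<noteq> 0" by auto
    let ?l = "if H n g (X s) < 0 then - g else g"
    have "s \<in> ball t e" using ab s by (auto simp: dist_real_def)
    then have "?r s < - k" using e(2) by blast
    moreover have "v * (2 * ?l * X s $ 1) \<le> \<bar>v * (2 * ?l * X s $ 1)\<bar>" by simp
    moreover have "\<bar>v * (2 * ?l * X s $ 1)\<bar> = 2 * g * \<bar>X s $ 1\<bar>"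
      using v g0 by (simp add: abs_mult)
    ultimately have "v * (2 * ?l * X s $ 1 - X s $ 2) + k \<le> 0" by (simp add: right_diff_distrib)
    moreover have "((\<lambda>s. v * X s $ 1 + k * s) has_real_derivative
        v * (2 * ?l * X s $ 1 - X s $ 2) + k) (at s)"
      by (rule derivative_eq_intros sol_derivative(1)[OF Hs] refl | simp)+
    ultimately show "\<exists>d\<le>0. ((\<lambda>s. v * X s $ 1 + k * s) has_real_derivative d) (at s)" by blast
  qed (intro continuous_intros sol_continuous)
  have "X s $ 1 \<noteq> 0" if "dist s t < e" "s \<noteq> t" for s
  proof
    assume "X s $ 1 = 0"
    then have "k * max s t \<le> k * min s t"
      using mono[of "min s t" "max s t"] that x0 e(1) by (auto simp: min_def max_def dist_commute)
    then show False using k(1) that(2) by (auto simp: min_def max_def split: if_splits)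
  qed
  then show ?thesis unfolding islimpt_approachable using e(1) by auto
qed

text \<open>The set \<open>Z\<close> collects the times where the orbit meets the switching curve or the
  \<open>y\<close>-axis, across which \<^term>\<open>W\<close> is not differentiable.\<close>
lemma sol_polar_lift:
  assumes nz: "X 0 \<noteq> 0"
  obtains th f Z where "continuous_on UNIV th" "continuous_on UNIV f"
    "\<And>t. W (X t) = of_real (exp (f t + g * arccos (cos (th t)))) * cis (th t)"
    "\<And>a b. finite (Z \<inter> {a..b})"
    "\<And>t. t \<notin> Z \<Longrightarrow> (th has_real_derivative
      (if X t $ 1 > 0 \<and> H n g (X t) < 0
       then 1 + 4 * g * sin (th t) * (g * sin (th t) - cos (th t)) else 1)) (at t)"
    "\<And>t. t \<notin> Z \<Longrightarrow> (f has_real_derivative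
      (if X t $ 1 > 0 \<and> H n g (X t) < 0 then - 4 * g * c * (sin (th t))\<^sup>2 else 0)) (at t)"
proof -
  have nz': "X t \<noteq> 0" for t using sol_nonzero[OF nz] .
  have contW: "continuous_on UNIV (\<lambda>t. W (X t))"
    by (rule continuous_on_compose2[OF continuous_on_W sol_continuous]) auto
  \<comment> \<open>A nonvanishing curve has a continuous logarithm. Its imaginary part is the
    angle; its derivative off \<open>Z\<close> is recovered from that of W X.\<close>
  obtain L where L: "continuous_on UNIV L" "\<And>t. W (X t) = exp (L t)"
    using continuous_logarithm_on_contractible[OF contW] nz' by auto
  define th where "th t = Im (L t)" for t
  define f where "f t = Re (L t) - g * arccos (cos (th t))" for t
  define Z where "Z = {t. X t $ 1 * H n g (X t) = 0}"
  have th_cont: "continuous_on UNIV th"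
    unfolding th_def by (intro continuous_intros L)
  have f_cont: "continuous_on UNIV f"
    unfolding f_def by (intro continuous_intros L th_cont continuous_on_arccos) auto
  have W_eq: "W (X t) = of_real (exp (f t + g * arccos (cos (th t)))) * cis (th t)" for t
    by (simp add: L(2) f_def th_def exp_eq_polar)
  have x_eq: "X t $ 1 = exp (Re (L t)) * sin (th t)" for t
    using arg_cong[OF L(2)[of t], of Im] by (simp add: Im_exp th_def)
  have p_eq: "g * \<bar>X t $ 1\<bar> - X t $ 2 = exp (Re (L t)) * cos (th t)" for t
    using arg_cong[OF L(2)[of t], of Re] by (simp add: Re_exp th_def)
  have fin: "finite (Z \<inter> {a..b})" for a b
  proof (rule finite_isolated_Int_interval)
    show "closed Z"
      unfolding Z_def by (intro closed_Collect_eq continuous_intros sol_continuous sol_continuous_H)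
    fix t
    have "\<not> t islimpt {s. X s $ 1 = 0}"
    proof (cases "X t $ 1 = 0")
      case False
      have "closed {s. X s $ 1 = 0}" by (intro closed_Collect_eq continuous_intros sol_continuous)
      then show ?thesis using False closed_limpt by blast
    qed (use sol_x_zero_not_islimpt nz' in blast)
    moreover have "\<not> t islimpt {s. H n g (X s) = 0}"
    proof (cases "H n g (X t) = 0")
      case False
      have "closed {s. H n g (X s) = 0}" by (intro closed_Collect_eq continuous_intros sol_continuous_H)
      then show ?thesis using False closed_limpt by blast
    next
      case True
      then show ?thesis
        using sol nz' unfolding pw_solution_def by (intro crosses_not_islimpt[of "\<lambda>t. H n g (X t)"]) auto
    qed
    moreover have "Z = {s. X s $ 1 = 0} \<union> {s. H n g (X s) = 0}" by (auto simp: Z_def)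
    ultimately show "\<not> t islimpt Z" by (simp add: islimpt_Un)
  qed
  have der: "(th has_real_derivative
      (if X t $ 1 > 0 \<and> H n g (X t) < 0
       then 1 + 4 * g * sin (th t) * (g * sin (th t) - cos (th t)) else 1)) (at t) \<and>
    (f has_real_derivative
      (if X t $ 1 > 0 \<and> H n g (X t) < 0 then - 4 * g * c * (sin (th t))\<^sup>2 else 0)) (at t)"
    if t: "t \<notin> Z" for t
  proof -
    let ?x = "X t $ 1" and ?y = "X t $ 2"
    define s where "s = (if H n g (X t) < 0 then - g else g)"
    have xH: "?x \<noteq> 0" "H n g (X t) \<noteq> 0" using t by (auto simp: Z_def)
    \<comment> \<open>\<open>q'\<close> and \<open>p'\<close> are the derivatives of the imaginary
      and the real part of W X; the sign of x stems from |x| in \<open>W\<close>.\<close>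
    define q' where "q' = 2 * s * ?x - ?y"
    define p' where "p' = g * (sgn ?x * q') - c * ?x"
    note D = sol_derivative[OF xH(2), folded s_def, folded q'_def]
    have "((\<lambda>t. \<bar>X t $ 1\<bar>) has_real_derivative sgn ?x * q') (at t)"
      using DERIV_chain2[OF DERIV_abs[OF xH(1)] D(1)] .
    then have "((\<lambda>t. Re (W (X t))) has_real_derivative p') (at t)"
      unfolding W_simps p'_def by (intro DERIV_diff DERIV_cmult D(2))
    then have "((\<lambda>t. W (X t)) has_vector_derivative Complex p' q') (at t)"
      using D(1) by (simp add: has_vector_derivative_complex_iff has_real_derivative_iff_has_vector_derivative)
    then have "((\<lambda>t. exp (L t)) has_vector_derivative Complex p' q') (at t)"
      by (simp only: L(2))
    moreover have "isCont L t" using L(1) by (simp add: continuous_on_eq_continuous_at)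
    ultimately have "(L has_vector_derivative Complex p' q' / exp (L t)) (at t)"
      by (rule has_vector_derivative_of_continuous_log[rotated])
    then have L': "((\<lambda>t. Re (L t)) has_real_derivative Re (Complex p' q' / exp (L t))) (at t)"
      "(th has_real_derivative Im (Complex p' q' / exp (L t))) (at t)"
      unfolding th_def
      by (simp_all only: has_vector_derivative_complex_iff has_real_derivative_iff_has_vector_derivative)
    have sg: "sgn (sin (th t)) = sgn ?x" by (simp add: x_eq sgn_mult)
    then have "sin (th t) \<noteq> 0" using xH(1) by (metis sgn_0_0)
    then have f': "(f has_real_derivative Re (Complex p' q' / exp (L t))
        - g * (sgn ?x * Im (Complex p' q' / exp (L t)))) (at t)"
      unfolding f_def sg[symmetric]
      by (intro DERIV_diff L' DERIV_cmult DERIV_chain2[OF DERIV_arccos_cos])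
    have expL: "exp (L t) = Complex (g * \<bar>?x\<bar> - ?y) ?x" using L(2)[of t] by (simp add: W_def)
    have y_eq: "?y = g * \<bar>?x\<bar> - Re (exp (L t))" by (simp add: expL)
    \<comment> \<open>The combination x < 0, H > 0 is impossible because \<open>h\<close> is
      nonnegative. Only in the third case does the acting field differ from that of the unswitched
      centre.\<close>
    consider "?x < 0" "s = - g" | "?x > 0" "H n g (X t) > 0" "s = g" | "?x > 0" "H n g (X t) < 0" "s = - g"
    proof -
      have "H n g (X t) < 0" if "?x < 0" using that h_nonneg[of ?y] by (auto simp: H_def)
      then show thesis using that xH by (cases "?x < 0"; cases "H n g (X t) < 0") (auto simp: s_def)
    qed
    then show ?thesis
    proof cases
      case 1
      then have "Complex p' q' = Complex (- g) 1 * exp (L t)"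
        by (simp add: expL p'_def q'_def complex_eq_iff algebra_simps power2_eq_square)
      then have "Complex p' q' / exp (L t) = Complex (- g) 1" by simp
      then show ?thesis using L'(2) f' 1 by simp
    next
      case 2
      then have "Complex p' q' = Complex g 1 * exp (L t)"
        by (simp add: expL p'_def q'_def complex_eq_iff algebra_simps power2_eq_square)
      then have "Complex p' q' / exp (L t) = Complex g 1" by simp
      then show ?thesis using L'(2) f' 2 by simp
    next
      case 3
      \<comment> \<open>For x > 0, replacing G^+ by G^- subtracts 4 g x from x', which in the
        coordinate \<open>W\<close> is (g + i) 4 g x. Expressing x as sin th * cis (- th) * W lets W
        cancel from the quotient.\<close>
      have "of_real ?x = of_real (sin (th t)) * cis (- th t) * exp (L t)"
      proof -
        have "of_real (sin (th t)) * cis (- th t) * exp (L t)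
            = of_real (exp (Re (L t)) * sin (th t)) * (cis (- th t) * cis (th t))"
          by (simp add: exp_eq_polar[of "L t"] th_def[symmetric] mult_ac)
        also have "\<dots> = of_real ?x" by (simp add: x_eq cis_mult)
        finally show ?thesis by (rule sym)
      qed
      moreover have "Complex p' q' = Complex g 1 * (exp (L t) - of_real (4 * g) * of_real ?x)"
        using 3 by (simp add: expL p'_def q'_def complex_eq_iff algebra_simps power2_eq_square)
      ultimately have "Complex p' q' = Complex g 1 * (1 - of_real (4 * g) * (of_real (sin (th t)) * cis (- th t)))
          * exp (L t)"
        by (simp add: algebra_simps)
      then have e: "Complex p' q' / exp (L t) = Complex g 1 * (1 - of_real (4 * g) * (of_real (sin (th t)) * cis (- th t)))"
        by simp
      have ri: "Re (Complex p' q' / exp (L t)) = g - 4 * g * sin (th t) * (g * cos (th t) + sin (th t))"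
        "Im (Complex p' q' / exp (L t)) = 1 + 4 * g * sin (th t) * (g * sin (th t) - cos (th t))"
        unfolding e by (simp_all add: algebra_simps)
      \<comment> \<open>The terms g cancel, and so do the mixed terms in sin th * cos th. What
        remains is a square, which gives the drop of the gauge its sign.\<close>
      have "Re (Complex p' q' / exp (L t)) - g * (sgn ?x * Im (Complex p' q' / exp (L t)))
          = - 4 * g * c * (sin (th t))\<^sup>2"
        using 3 unfolding ri by (simp add: algebra_simps power2_eq_square)
      from L'(2)[unfolded ri] f'[unfolded this] show ?thesis using 3 by simp
    qed
  qed
  show thesis by (rule that[OF th_cont f_cont W_eq fin]) (use der in blast)+
qed

end

text \<open>\<open>th\<close> is a continuous argument of \<open>W X\<close> and \<open>f = ln (N X)\<close>.\<close>
definition polar_lift :: "(real \<Rightarrow> real^2) \<Rightarrow> (real \<Rightarrow> real) \<Rightarrow> (real \<Rightarrow> real) \<Rightarrow> bool" where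
  "polar_lift X th f \<longleftrightarrow> continuous_on UNIV th \<and> continuous_on UNIV f \<and>
    (\<forall>t. W (X t) = of_real (exp (f t + g * arccos (cos (th t)))) * cis (th t)) \<and>
    (\<exists>Z. (\<forall>a b. finite (Z \<inter> {a..b})) \<and> (\<forall>t. t \<notin> Z \<longrightarrow>
      (th has_real_derivative
      (if X t $ 1 > 0 \<and> H n g (X t) < 0
       then 1 + 4 * g * sin (th t) * (g * sin (th t) - cos (th t)) else 1)) (at t) \<and>
      (f has_real_derivative
      (if X t $ 1 > 0 \<and> H n g (X t) < 0 then - 4 * g * c * (sin (th t))\<^sup>2 else 0)) (at t)))"

lemma polar_lift_exists:
  assumes "pw_solution n g X" "X 0 \<noteq> 0"
  obtains th f where "polar_lift X th f"
proof (rule sol_polar_lift[OF assms], goal_cases)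
  case (1 th f Z)
  show thesis
  proof (rule that[of th f], unfold polar_lift_def, intro conjI allI exI[of _ Z] impI)
  qed (use 1 in blast)+
qed

text \<open>The value of \<^term>\<open>N\<close> at \<open>(0, 2k)\<close>.\<close>
definition radius :: "nat \<Rightarrow> real" where
  "radius k = 2 * real k * exp (- g * pi)"

lemma radius_pos: "k \<in> {1..n} \<Longrightarrow> radius k > 0"
  by (simp add: radius_def)

lemma radius_top: "radius k * exp (g * pi) = 2 * real k"
  by (simp add: radius_def mult.assoc exp_add[symmetric])

text \<open>The right half of this level set is the G^+ arc from (0, - radius k) to (0, 2k). Since
  \<open>h\<close> vanishes at 2k, the arc meets the switching curve at time pi, and uniqueness of
  the crossing leaves H > 0 before.\<close>

lemma right_of_level_set:
  assumes k: "k \<in> {1..n}" and p: "N p = radius k" "p $ 1 > 0"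
  shows "H n g p > 0"
proof -
  have "p \<noteq> 0" using p(2) by auto
  then obtain r t where rt: "r > 0" "0 \<le> t" "t < 2 * pi" "W p = of_real r * cis t"
    by (rule polar_form)
  have "r * sin t > 0" using arg_cong[OF rt(4), of Im] p(2) by simp
  then have "sin t > 0" using rt(1) by (rule zero_less_mult_pos)
  then have "t \<noteq> 0" by auto
  then have t: "0 < t" "t < pi"
    using rt(2,3) sin_le_zero[of t] \<open>sin t > 0\<close> by linarith+
  have "radius k = r * exp (- g * t)"
    using N_polar[OF rt(1,4)] p(1) t by (simp add: arccos_cos)
  then have r: "r = radius k * exp (g * t)" by (simp add: mult.assoc exp_add[symmetric])
  have "W p = W (radius k *\<^sub>R E g t)"
    using W_E_right[of "radius k" t] radius_pos[OF k] \<open>sin t > 0\<close> by (simp add: rt(4) r del: W_simps)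
  then have pE: "p = radius k *\<^sub>R E g t" by (rule W_inj)
  have H0: "H n g (radius k *\<^sub>R E g pi) = 0"
    using k h_eq_zero_iff[of "2 * real k"] by (auto simp: H_def radius_top)
  obtain z where z: "z \<le> pi"
    "\<And>t. \<lbrakk>0 < t; t < z\<rbrakk> \<Longrightarrow> H n g (radius k *\<^sub>R E g t) > 0"
    "\<And>t. \<lbrakk>z < t; t < 2 * pi\<rbrakk> \<Longrightarrow> H n g (radius k *\<^sub>R E g t) < 0"
    by (rule crossing_time[OF radius_pos[OF k], of g]) auto
  have "\<not> z < pi" using z(3)[of pi] H0 pi_gt_zero by (metis less_add_same_cancel1 less_irrefl mult_2)
  then have "z = pi" using z(1) order.strict_iff_order by metis
  then show ?thesis using z(2)[of t] t pE by simp
qed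

section \<open>Angle and logarithmic gauge along a solution\<close>

context
  fixes X th f
  assumes lift: "polar_lift X th f"
begin

lemma th_continuous: "continuous_on S th" and f_continuous: "continuous_on S f"
  using lift continuous_on_subset unfolding polar_lift_def by blast+

lemma lift_W: "W (X t) = of_real (exp (f t + g * arccos (cos (th t)))) * cis (th t)"
  using lift unfolding polar_lift_def by blast

lemma lift_N: "N (X t) = exp (f t)"
  by (subst N_polar[OF _ lift_W]) (simp_all add: mult_exp_exp)

lemma lift_x: "X t $ 1 = exp (f t + g * arccos (cos (th t))) * sin (th t)"
  using arg_cong[OF lift_W[of t], of Im] by simp

lemma lift_y: "X t $ 2 = exp (f t + g * arccos (cos (th t))) * (g * \<bar>sin (th t)\<bar> - cos (th t))"
proof -
  have "g * \<bar>X t $ 1\<bar> - X t $ 2 = exp (f t + g * arccos (cos (th t))) * cos (th t)"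
    using arg_cong[OF lift_W[of t], of Re] by simp
  then show ?thesis by (simp add: lift_x abs_mult algebra_simps)
qed

lemma lift_nonzero: "X t \<noteq> 0"
  using lift_N[of t] N_pos_iff[of "X t"] by simp

lemma lift_X_continuous: "continuous_on S X"
proof -
  have "continuous_on S (\<lambda>t. W (X t))"
    unfolding lift_W
    by (intro continuous_intros f_continuous th_continuous continuous_on_arccos) auto
  from continuous_on_V[OF this] show ?thesis by simp
qed

text \<open>All estimates on angle and gauge assert that some linear combination of
  \<open>th\<close>, \<open>f\<close> and t does not increase. Where the fields agree with the
  centre, its slope is alpha + kappa; in the remaining region the signs of sin th and g sin th - cos
  th are made available.\<close>

lemma lift_combination_nonincreasing:
  assumes ab: "a \<le> b"
    and out: "\<And>t. \<lbrakk>a < t; t < b; \<not> (X t $ 1 > 0 \<and> H n g (X t) < 0)\<rbrakk> \<Longrightarrow> \<alpha> + \<kappa> \<le> 0"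
    and "in": "\<And>t. \<lbrakk>a < t; t < b; X t $ 1 > 0; H n g (X t) < 0; sin (th t) > 0;
        g * sin (th t) - cos (th t) > 0\<rbrakk> \<Longrightarrow>
      \<alpha> * (1 + 4 * g * sin (th t) * (g * sin (th t) - cos (th t))) - \<beta> * (4 * g * c * (sin (th t))\<^sup>2) + \<kappa> \<le> 0"
  shows "\<alpha> * th b + \<beta> * f b + \<kappa> * b \<le> \<alpha> * th a + \<beta> * f a + \<kappa> * a"
proof -
  obtain Z where Z: "\<And>a b. finite (Z \<inter> {a..b})"
    "\<And>t. t \<notin> Z \<Longrightarrow> (th has_real_derivative
      (if X t $ 1 > 0 \<and> H n g (X t) < 0
       then 1 + 4 * g * sin (th t) * (g * sin (th t) - cos (th t)) else 1)) (at t)"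
    "\<And>t. t \<notin> Z \<Longrightarrow> (f has_real_derivative
      (if X t $ 1 > 0 \<and> H n g (X t) < 0 then - 4 * g * c * (sin (th t))\<^sup>2 else 0)) (at t)"
    using lift unfolding polar_lift_def by blast
  show ?thesis
  proof (rule nonincreasing_if_deriv_nonpos_finite[OF ab _ Z(1)[of a b]])
    fix t assume t: "a < t" "t < b" "t \<notin> Z \<inter> {a..b}"
    then have "t \<notin> Z" by auto
    note D = Z(2,3)[OF this]
    have E: "((\<lambda>t. \<alpha> * th t + \<beta> * f t + \<kappa> * t) has_real_derivative
        \<alpha> * (if X t $ 1 > 0 \<and> H n g (X t) < 0
         then 1 + 4 * g * sin (th t) * (g * sin (th t) - cos (th t)) else 1) +
        \<beta> * (if X t $ 1 > 0 \<and> H n g (X t) < 0 then - 4 * g * c * (sin (th t))\<^sup>2 else 0) + \<kappa> * 1) (at t)"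
      by (intro DERIV_add DERIV_cmult D DERIV_ident)
    show "\<exists>d\<le>0. ((\<lambda>t. \<alpha> * th t + \<beta> * f t + \<kappa> * t) has_real_derivative d) (at t)"
    proof (cases "X t $ 1 > 0 \<and> H n g (X t) < 0")
      case False
      then have "(X t $ 1 > 0 \<and> H n g (X t) < 0) = False" by blast
      from E[unfolded this] show ?thesis
        using out[OF t(1,2) False] by (intro exI[of _ "\<alpha> + \<kappa>"]) simp
    next
      case True
      \<comment> \<open>H is x for y <= 0, so x > 0 > H forces y > 0. The resulting sign of g sin th
        - cos th is what keeps the angular speed at least 1.\<close>
      then have "X t $ 2 > 0" by (auto simp: H_def split: if_splits)
      moreover have s: "sin (th t) > 0" using True by (simp add: lift_x zero_less_mult_iff)
      ultimately have "g * sin (th t) - cos (th t) > 0" by (simp add: lift_y zero_less_mult_iff)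
      from "in"[OF t(1,2) _ _ s this] True
      have "\<alpha> * (1 + 4 * g * sin (th t) * (g * sin (th t) - cos (th t))) +
        \<beta> * (- 4 * g * c * (sin (th t))\<^sup>2) + \<kappa> * 1 \<le> 0" by simp
      moreover have "(X t $ 1 > 0 \<and> H n g (X t) < 0) = True" using True by blast
      ultimately show ?thesis using E by (intro exI conjI) (assumption, simp only: if_True)
    qed
  qed (intro continuous_intros th_continuous f_continuous)
qed

lemma f_antimono: "s \<le> t \<Longrightarrow> f t \<le> f s"
  \<comment> \<open>The parameters are instantiated in the order alpha, kappa, beta.\<close>
  using lift_combination_nonincreasing[of s t 0 0 1] g0 c_pos by simp

lemma th_expanding: "s \<le> t \<Longrightarrow> t - s \<le> th t - th s"
  using lift_combination_nonincreasing[of s t "-1" 1 0] g0 by simp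

text \<open>With beta = -1 the condition inside the region is void by assumption, so - f does not
  increase either.\<close>

lemma f_constant_outside:
  assumes "s \<le> t" "\<And>r. \<lbrakk>s < r; r < t\<rbrakk> \<Longrightarrow> \<not> (X r $ 1 > 0 \<and> H n g (X r) < 0)"
  shows "f t = f s"
  using lift_combination_nonincreasing[of s t 0 0 "-1"] f_antimono[OF assms(1)] assms by force

text \<open>If \<open>h\<close> were positive at the top point of the limiting level set, a whole
  window of angles just before pi would lie in the region of decrease, and each passage through it
  would cost \<open>f\<close> a fixed amount. Closeness to \<open>l\<close> is asked on one interval
  of length 4 pi, long enough to contain a passage; this form serves both time directions and
  constant \<open>f\<close>.\<close>

lemma limit_radius:
  assumes lim: "\<And>e. e > 0 \<Longrightarrow> \<exists>u. \<forall>t\<in>{u..u + 4 * pi}. \<bar>f t - l\<bar> < e"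
  obtains k where "k \<in> {1..n}" "exp l = radius k"
proof -
  let ?Y = "exp (l + g * pi)"
  have "h n g ?Y = 0"
  proof (rule ccontr)
    assume "h n g ?Y \<noteq> 0"
    then have hY: "h n g ?Y > 0" using h_nonneg[of ?Y] by linarith
    \<comment> \<open>\<open>P\<close> is H at the point with logarithmic gauge \<open>fst z\<close>
      and angle \<open>snd z\<close>, for angles in [0, pi], where arccos (cos t) = t.\<close>
    define P where "P z = H n g (V (of_real (exp (fst z + g * snd z)) * cis (snd z)))" for z :: "real \<times> real"
    have "continuous_on UNIV P"
      unfolding P_def
      by (rule continuous_on_compose2[OF continuous_on_H]) (auto intro!: continuous_intros)
    then have "open {z. P z < 0}" by (intro open_Collect_less) auto
    moreover have "(l, pi) \<in> {z. P z < 0}" using hY by (simp add: P_def H_def)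
    ultimately obtain e where e: "e > 0" "ball (l, pi) e \<subseteq> {z. P z < 0}" by (rule openE)
    obtain d where d: "0 < d" "d < e / 2" "d < pi / 2"
      using dense[of 0 "min (e/2) (pi/2)"] e(1) pi_gt_zero by auto
    define m where "m = (sin (d / 2))\<^sup>2"
    have sd: "sin (d/2) > 0" using d by (intro sin_gt_zero) auto
    then have m: "m > 0" by (simp add: m_def)
    \<comment> \<open>\<open>M\<close> bounds the angular speed and \<open>4 * g * c * m\<close>
      bounds the rate of fall of \<open>f\<close> from below inside the window, so \<open>f\<close>
      loses at least \<open>k\<close> per unit of angle.\<close>
    define M where "M = 1 + 4 * g * (g + 1)"
    have M: "M > 0" using g0 by (simp add: M_def add_pos_pos)
    define k where "k = 4 * g * c * m / M"
    have k: "k > 0" "k * M = 4 * g * c * m" using m M g0 c_pos by (simp_all add: k_def)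
    obtain u where u: "\<And>t. t \<in> {u..u + 4 * pi} \<Longrightarrow> \<bar>f t - l\<bar> < min (e/2) (k * d / 4)"
    proof -
      have "min (e/2) (k * d / 4) > 0" using e(1) k d by simp
      from lim[OF this] show thesis using that by blast
    qed
    \<comment> \<open>\<open>?o\<close> is the multiple of 2 pi for which the window opens at or
      after \<open>th u\<close>, by less than one revolution. The angle gains at least 4 pi on the
      interval, so the whole window is passed.\<close>
    define j where "j = \<lceil>(th u - pi + d) / (2 * pi)\<rceil>"
    let ?o = "2 * pi * real_of_int j"
    have "(th u - pi + d) / (2 * pi) \<le> j" "j < (th u - pi + d) / (2 * pi) + 1"
      unfolding j_def by linarith+
    then have j: "th u - pi + d \<le> ?o" "?o < th u - pi + d + 2 * pi"
      by (simp_all add: field_simps)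
    have th_end: "th (u + 4 * pi) \<ge> th u + 4 * pi" using th_expanding[of u "u + 4 * pi"] by simp
    obtain t1 where t1: "u \<le> t1" "t1 \<le> u + 4 * pi" "th t1 = ?o + pi - d"
      using IVT'[of th u "?o + pi - d" "u + 4 * pi"] th_continuous th_end j d by fastforce
    obtain t2 where t2: "t1 \<le> t2" "t2 \<le> u + 4 * pi" "th t2 = ?o + pi - d / 2"
      using IVT'[of th t1 "?o + pi - d / 2" "u + 4 * pi"] th_continuous th_end t1 j d by fastforce
    have window: "X t $ 1 > 0 \<and> H n g (X t) < 0 \<and> (sin (th t))\<^sup>2 \<ge> m" if t: "t1 < t" "t < t2" for t
    proof -
      define a where "a = th t - ?o"
      have a: "pi - d \<le> a" "a \<le> pi - d / 2"
        using th_expanding[of t1 t] th_expanding[of t t2] t t1 t2 by (auto simp: a_def)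
      have per: "sin (th t) = sin a" "cos (th t) = cos a" "cis (th t) = cis a"
      proof -
        have "th t = a + 2 * pi * of_int j" by (simp add: a_def)
        then show *: "sin (th t) = sin a" "cos (th t) = cos a"
          using sin_cos_eq_iff[of "th t" a] by (auto simp: mult_ac)
        then show "cis (th t) = cis a" by (simp add: complex_eq_iff)
      qed
      have "arccos (cos a) = a" using a d by (intro arccos_cos) auto
      then have W: "W (X t) = of_real (exp (f t + g * a)) * cis a"
        using lift_W[of t] by (simp add: per)
      have "dist (f t, a) (l, pi) \<le> dist (f t) l + dist a pi"
        using sqrt_add_le_add_sqrt[of "(dist (f t) l)\<^sup>2" "(dist a pi)\<^sup>2"] by (simp add: dist_Pair_Pair)
      also have "\<dots> < e" using u[of t] t t1 t2 a d by (auto simp: dist_real_def)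
      finally have "(f t, a) \<in> ball (l, pi) e" by (simp add: dist_commute)
      then have "P (f t, a) < 0" using e(2) by blast
      then have "H n g (X t) < 0" using arg_cong[OF W, of V] by (simp add: P_def)
      moreover have "sin a = sin (pi - a)" by simp
      moreover have "sin (d/2) \<le> sin (pi - a)" using a d by (intro sin_monotone_2pi_le) auto
      ultimately show ?thesis
        using sd by (simp add: per lift_x m_def power_mono)
    qed
    have "k * th t2 + 1 * f t2 + 0 * t2 \<le> k * th t1 + 1 * f t1 + 0 * t1"
    proof (rule lift_combination_nonincreasing[OF t2(1)])
      fix t assume t: "t1 < t" "t < t2" "sin (th t) > 0"
      have "4 * g * sin (th t) * (g * sin (th t) - cos (th t)) \<le> 4 * g * 1 * (g * 1 + 1)"
      proof (rule order_trans[OF mult_left_mono[of _ "g * 1 + 1"]])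
        have "g * sin (th t) \<le> g * 1" using g0 by (intro mult_left_mono) auto
        then show "g * sin (th t) - cos (th t) \<le> g * 1 + 1"
          using cos_ge_minus_one[of "th t"] by linarith
      qed (use t(3) g0 in \<open>auto intro!: mult_right_mono\<close>)
      then have "k * (1 + 4 * g * sin (th t) * (g * sin (th t) - cos (th t))) \<le> k * M"
        using k(1) by (intro mult_left_mono) (auto simp: M_def)
      also have "\<dots> \<le> 4 * g * c * (sin (th t))\<^sup>2"
        unfolding k(2) using window[OF t(1,2)] g0 c_pos by (intro mult_left_mono) auto
      finally show "k * (1 + 4 * g * sin (th t) * (g * sin (th t) - cos (th t)))
          - 1 * (4 * g * c * (sin (th t))\<^sup>2) + 0 \<le> 0" by simp
    qed (use window in auto)
    \<comment> \<open>Crossing the window costs at least k d / 2, yet both end values are closer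
      than k d / 4 to \<open>l\<close>.\<close>
    then have "k * (d / 2) \<le> f t1 - f t2" by (simp add: t1(3) t2(3) algebra_simps)
    moreover have "\<bar>f t1 - l\<bar> < k * d / 4" "\<bar>f t2 - l\<bar> < k * d / 4"
      using u[of t1] u[of t2] t1 t2 by auto
    ultimately show False by (simp add: abs_if split: if_splits)
  qed
  then obtain k where k: "k \<in> {1..n}" "?Y = 2 * real k" using h_eq_zero_iff[of ?Y] by auto
  then have "exp l = radius k" by (simp add: radius_def exp_add flip: k(2))
     (simp add: mult.assoc exp_add[symmetric])
  then show thesis using k that by blast
qed

text \<open>At the last time \<open>b\<close> with \<open>f >= l\<close> the solution is on the
  level set. From each of its points a solution stays for a while outside the region of decrease, so
  \<open>f\<close> is constant just after \<open>b\<close>, contrary to the choice of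
  \<open>b\<close>.\<close>

lemma barrier:
  assumes k: "k \<in> {1..n}" and "N (X s) \<ge> radius k" "s \<le> t"
  shows "N (X t) \<ge> radius k"
proof (rule ccontr)
  assume "\<not> N (X t) \<ge> radius k"
  define l where "l = ln (radius k)"
  have l: "exp l = radius k" using radius_pos[OF k] by (simp add: l_def)
  have fs: "f s \<ge> l" using assms(2) by (simp add: lift_N flip: l)
  have ft: "f t < l" using \<open>\<not> N (X t) \<ge> radius k\<close> by (simp add: lift_N flip: l)
  define R where "R = {s..t} \<inter> {r. f r \<ge> l}"
  have "closed {r. f r \<ge> l}" using f_continuous by (intro closed_Collect_le) auto
  then have "compact R" unfolding R_def by (intro compact_Int_closed) auto
  moreover have "s \<in> R" using fs assms(3) by (simp add: R_def)
  ultimately obtain b where b: "b \<in> R" "\<And>r. r \<in> R \<Longrightarrow> r \<le> b"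
    using compact_attains_sup[of R] by blast
  have bt: "s \<le> b" "b < t" using b(1) ft by (auto simp: R_def order_le_less)
  have after: "f r < l" if "b < r" "r \<le> t" for r
    using b(2)[of r] that bt by (force simp: R_def)
  have fb: "f b = l"
  proof (rule ccontr)
    assume "f b \<noteq> l"
    then have "f b > l" using b(1) by (simp add: R_def)
    then obtain r where "b \<le> r" "r \<le> t" "f r = l"
      using IVT2'[of f t l b] ft bt f_continuous by force
    then show False using after[of r] \<open>f b > l\<close> by (cases "r = b") auto
  qed
  then have Nb: "N (X b) = radius k" by (simp add: lift_N l)
  have "\<exists>e>0. \<forall>r. b < r \<and> r < b + e \<longrightarrow> \<not> (X r $ 1 > 0 \<and> H n g (X r) < 0)"
  proof -
    have nbhd: ?thesis if S: "open S" "b \<in> S" "\<And>r. \<lbrakk>r \<in> S; b < r\<rbrakk> \<Longrightarrow> \<not> (X r $ 1 > 0 \<and> H n g (X r) < 0)" for S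
    proof -
      obtain e where "e > 0" "ball b e \<subseteq> S" using S(1,2) by (rule openE)
      then show ?thesis using S(3) by (intro exI[of _ e]) (auto simp: dist_real_def subset_iff)
    qed
    consider "X b $ 1 > 0" | "X b $ 1 < 0" | "X b $ 1 = 0" "X b $ 2 < 0" | "X b $ 1 = 0" "X b $ 2 > 0"
    proof -
      have "X b $ 1 \<noteq> 0 \<or> X b $ 2 \<noteq> 0" using lift_nonzero[of b] by (auto simp: vec_eq_iff forall_2)
      then show thesis
        using that less_linear[of "X b $ 1" 0] less_linear[of "X b $ 2" 0] by blast
    qed
    then show ?thesis
    proof cases
      case 1
      then have "H n g (X b) > 0" using right_of_level_set[OF k Nb] by simp
      moreover have "continuous_on UNIV (\<lambda>t. H n g (X t))"
        by (rule continuous_on_compose2[OF continuous_on_H lift_X_continuous]) auto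
      then have "open {r. H n g (X r) > 0}" by (intro open_Collect_less) auto
      ultimately show ?thesis by (intro nbhd) auto
    next
      case 2
      have "open {r. X r $ 1 < 0}" by (intro open_Collect_less continuous_intros lift_X_continuous)
      then show ?thesis using 2 by (intro nbhd) auto
    next
      case 3
      have "open {r. X r $ 2 < 0}" by (intro open_Collect_less continuous_intros lift_X_continuous)
      then show ?thesis using 3 by (intro nbhd) (auto simp: H_def)
    next
      \<comment> \<open>The top point is on the switching curve and in the closure of x > 0, so
        openness alone does not help. The angle is strictly increasing, which drives the solution
        into x < 0 at once.\<close>
      case 4
      then have "sin (th b) = 0" by (simp add: lift_x)
      then have cb: "cos (th b) = -1"
        using 4(2) sin_cos_squared_add[of "th b"]
        by (auto simp: lift_y zero_less_mult_iff power2_eq_1_iff)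
      have "open {r. th r < th b + pi}" by (intro open_Collect_less continuous_intros th_continuous)
      moreover have "X r $ 1 < 0" if "th r < th b + pi" "b < r" for r
      proof -
        have "sin (th r) = - sin (th r - th b)"
          using cb \<open>sin (th b) = 0\<close> by (simp add: sin_diff)
        moreover have "sin (th r - th b) > 0"
          using that th_expanding[of b r] by (intro sin_gt_zero) auto
        ultimately show ?thesis by (simp add: lift_x mult_pos_neg)
      qed
      ultimately show ?thesis by (intro nbhd[of "{r. th r < th b + pi}"]) force+
    qed
  qed
  then obtain e where e: "e > 0" "\<And>r. \<lbrakk>b < r; r < b + e\<rbrakk> \<Longrightarrow> \<not> (X r $ 1 > 0 \<and> H n g (X r) < 0)"
    by blast
  have "f (min (b + e) t) = f b"
    using e bt by (intro f_constant_outside) auto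
  then show False using after[of "min (b + e) t"] e(1) bt fb by auto
qed

end

end

section \<open>Existence of solutions\<close>

text \<open>Iterates of a chosen successor and a chosen predecessor supply the two halves. The chain
  carries turns over all of time, past and future.\<close>

lemma int_chain:
  assumes fwd: "\<And>a. P a \<Longrightarrow> \<exists>a'. P a' \<and> R a a'" and bwd: "\<And>a. P a \<Longrightarrow> \<exists>a'. P a' \<and> R a' a"
    and "P a0"
  obtains A :: "int \<Rightarrow> 'a" where "A 0 = a0" "\<And>k. P (A k)" "\<And>k. R (A k) (A (k + 1))"
proof -
  obtain f where f: "\<And>a. P a \<Longrightarrow> P (f a) \<and> R a (f a)" using fwd by metis
  obtain b where b: "\<And>a. P a \<Longrightarrow> P (b a) \<and> R (b a) a" using bwd by metis
  have Pf: "P ((f ^^ m) a0)" for m by (induction m) (use f \<open>P a0\<close> in auto)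
  have Pb: "P ((b ^^ m) a0)" for m by (induction m) (use b \<open>P a0\<close> in auto)
  define A where "A k = (if k \<ge> 0 then (f ^^ nat k) a0 else (b ^^ nat (- k)) a0)" for k :: int
  have "R (A k) (A (k + 1))" for k
  proof (cases "k \<ge> 0")
    case True
    then have "nat (k + 1) = Suc (nat k)" by simp
    then show ?thesis using True f Pf by (simp add: A_def)
  next
    case False
    then have "nat (- k) = Suc (nat (- (k + 1)))" by simp
    then have "A k = b ((b ^^ nat (- (k + 1))) a0)" using False by (simp add: A_def)
    moreover have "A (k + 1) = (b ^^ nat (- (k + 1))) a0" using False by (auto simp: A_def)
    ultimately show ?thesis using b Pb by simp
  qed
  then show thesis using that[of A] Pf Pb by (simp add: A_def)
qed

text \<open>The uniform step \<open>d\<close> excludes accumulation of the partition points, so the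
  intervals exhaust the line.\<close>

lemma int_partition_cover:
  fixes T :: "int \<Rightarrow> real"
  assumes step: "\<And>k. T (k + 1) \<ge> T k + d" and "d > 0"
  obtains k where "T k \<le> t" "t < T (k + 1)"
proof -
  have up: "T (int m) \<ge> T 0 + real m * d" for m
  proof (induction m)
    case (Suc m)
    then show ?case using step[of "int m"] by (simp add: algebra_simps)
  qed simp
  have down: "T (- int m) \<le> T 0 - real m * d" for m
  proof (induction m)
    case (Suc m)
    then show ?case using step[of "- int (Suc m)"] by (simp add: algebra_simps)
  qed simp
  obtain m1 where m1: "real m1 * d > t - T 0" using reals_Archimedean3[OF \<open>d > 0\<close>] by blast
  obtain m0 where m0: "real m0 * d > T 0 - t" using reals_Archimedean3[OF \<open>d > 0\<close>] by blast
  define S where "S = {k \<in> {- int m0..int m1}. T k \<le> t}"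
  have "- int m0 \<in> S" using down[of m0] m0 by (simp add: S_def)
  moreover have "finite S"
    by (rule finite_subset[of _ "{- int m0..int m1}"]) (auto simp: S_def)
  ultimately have S: "finite S" "Max S \<in> S" using Max_in by blast+
  have "Max S \<noteq> int m1" using S(2) up[of m1] m1 by (auto simp: S_def)
  then have "Max S + 1 \<in> {- int m0..int m1}" using S(2) by (auto simp: S_def)
  moreover have "Max S + 1 \<notin> S" using S(1) Max_ge[of S "Max S + 1"] by auto
  ultimately have "t < T (Max S + 1)" by (auto simp: S_def)
  then show thesis using that[of "Max S"] S(2) by (simp add: S_def)
qed

context two_zone
begin

text \<open>The coordinate \<open>w\<close> is the linear counterpart of \<open>W\<close> for a
  single flow: the flow of \<open>field s\<close> multiplies it by exp ((s + i) t).\<close>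

lemma polar_E:
  assumes "p \<noteq> 0"
  obtains a t where "a > 0" "0 \<le> t" "t < 2 * pi" "p = a *\<^sub>R E s t"
proof -
  define w where "w = Complex (s * p $ 1 - p $ 2) (p $ 1)"
  have "w \<noteq> 0" using assms by (auto simp: w_def complex_eq_iff vec_eq_iff forall_2)
  let ?t = "Arg2pi w" and ?a = "cmod w * exp (- s * Arg2pi w)"
  have w: "w = of_real (cmod w) * cis ?t"
    using Arg2pi[of w] by (simp add: cis_conv_exp is_Arg_def)
  have x: "p $ 1 = cmod w * sin ?t" using arg_cong[OF w, of Im] by (simp add: w_def)
  have "s * p $ 1 - p $ 2 = cmod w * cos ?t" using arg_cong[OF w, of Re] by (simp add: w_def)
  then have y: "p $ 2 = cmod w * (s * sin ?t - cos ?t)" by (simp add: x algebra_simps)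
  have e: "?a * exp (s * ?t) = cmod w" by (simp add: mult.assoc exp_add[symmetric])
  have "p = ?a *\<^sub>R E s ?t"
    unfolding vec_eq_iff forall_2 vector_scaleR_component E_nth real_scaleR_def mult.assoc[symmetric] e x y
    by simp
  then show thesis using \<open>w \<noteq> 0\<close> Arg2pi[of w] that[of ?a ?t] by simp
qed

lemma crossing_unique:
  assumes "a > 0" "s = g \<or> s = - g" "0 < t" "t \<le> pi" "H n g (a *\<^sub>R E s t) = 0"
  shows "\<lbrakk>0 < r; r < t\<rbrakk> \<Longrightarrow> H n g (a *\<^sub>R E s r) > 0"
    "\<lbrakk>t < r; r < 2 * pi\<rbrakk> \<Longrightarrow> H n g (a *\<^sub>R E s r) < 0"
proof -
  obtain z where z: "\<And>t. \<lbrakk>0 < t; t < z\<rbrakk> \<Longrightarrow> H n g (a *\<^sub>R E s t) > 0"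
    "\<And>t. \<lbrakk>z < t; t < 2 * pi\<rbrakk> \<Longrightarrow> H n g (a *\<^sub>R E s t) < 0"
    by (rule crossing_time[OF assms(1,2)]) auto
  have "t = z" using z(1)[of t] z(2)[of t] assms(3-5) pi_gt_zero by force
  then show "\<lbrakk>0 < r; r < t\<rbrakk> \<Longrightarrow> H n g (a *\<^sub>R E s r) > 0"
    "\<lbrakk>t < r; r < 2 * pi\<rbrakk> \<Longrightarrow> H n g (a *\<^sub>R E s r) < 0" using z by auto
qed

text \<open>A turn starts at \<open>(0, - a)\<close>, follows \<open>G\<^sup>+\<close> for the time \<open>z\<close> up to the switching curve and then \<open>G\<^sup>-\<close>
  down to the negative \<open>y\<close>-axis. The second arc is written as the part \<open>[z', 2\<pi>]\<close> of the \<open>G\<^sup>-\<close>-orbit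
  through \<open>(0, - b)\<close>, so the turn ends at \<open>(0, - b exp (- 2\<pi>g))\<close>.\<close>
definition is_turn :: "real \<Rightarrow> real \<Rightarrow> real \<Rightarrow> real \<Rightarrow> bool" where
  "is_turn a z b z' \<longleftrightarrow> a > 0 \<and> b > 0 \<and> 0 < z \<and> z \<le> pi \<and> 0 < z' \<and> z' \<le> pi \<and>
    a *\<^sub>R E g z = b *\<^sub>R E (- g) z' \<and> H n g (a *\<^sub>R E g z) = 0"

definition turn :: "real \<Rightarrow> real \<Rightarrow> real \<Rightarrow> real \<Rightarrow> real \<Rightarrow> real^2" where
  "turn a z b z' t = (if t \<le> z then a *\<^sub>R E g t else b *\<^sub>R E (- g) (t - (z - z')))"

lemma is_turnD:
  assumes "is_turn a z b z'"
  shows "a > 0" "b > 0" "0 < z" "z \<le> pi" "0 < z'" "z' \<le> pi"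
    "a *\<^sub>R E g z = b *\<^sub>R E (- g) z'" "H n g (a *\<^sub>R E g z) = 0" "H n g (b *\<^sub>R E (- g) z') = 0"
proof -
  show "a > 0" "b > 0" "0 < z" "z \<le> pi" "0 < z'" "z' \<le> pi"
    and e: "a *\<^sub>R E g z = b *\<^sub>R E (- g) z'" "H n g (a *\<^sub>R E g z) = 0"
    using assms unfolding is_turn_def by blast+
  then show "H n g (b *\<^sub>R E (- g) z') = 0" by simp
qed

lemma is_turn_sides:
  assumes "is_turn a z b z'"
  shows "\<lbrakk>0 < r; r < z\<rbrakk> \<Longrightarrow> H n g (a *\<^sub>R E g r) > 0"
    "\<lbrakk>z' < r; r < 2 * pi\<rbrakk> \<Longrightarrow> H n g (b *\<^sub>R E (- g) r) < 0"
  using crossing_unique(1)[OF is_turnD(1)[OF assms] disjI1[OF refl] is_turnD(3,4,8)[OF assms]]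
    crossing_unique(2)[OF is_turnD(2)[OF assms] disjI2[OF refl] is_turnD(5,6,9)[OF assms]]
  by blast+

text \<open>A crossing point has x = h(y) >= 0 and y > 0. In the angle of any other flow these signs
  give sin t >= 0 and t > 0, hence a parameter in (0, pi].\<close>

lemma crossing_in_other_flow:
  assumes "a > 0" "s = g \<or> s = - g"
  obtains z b z' where "0 < z" "z \<le> pi" "b > 0" "0 < z'" "z' \<le> pi"
    "a *\<^sub>R E s z = b *\<^sub>R E s' z'" "H n g (a *\<^sub>R E s z) = 0"
proof -
  obtain z where z: "0 < z" "z \<le> pi" "H n g (a *\<^sub>R E s z) = 0" "(a *\<^sub>R E s z) $ 2 > 0"
    by (rule crossing_time[OF assms])
  let ?q = "a *\<^sub>R E s z"
  have "?q \<noteq> 0" using z(4) by (metis less_irrefl zero_index)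
  then obtain b t where t: "b > 0" "0 \<le> t" "t < 2 * pi" "?q = b *\<^sub>R E s' t" by (rule polar_E)
  have "?q $ 1 = h n g (?q $ 2)" using z(3,4) by (simp add: H_def)
  then have "?q $ 1 \<ge> 0" using h_nonneg by simp
  then have "(b *\<^sub>R E s' t) $ 1 \<ge> 0" using t(4) by simp
  then have "sin t \<ge> 0" using t(1) by (simp add: zero_le_mult_iff)
  then have "t \<le> pi" using sin_lt_zero[of t] t(3) by linarith
  moreover have "t \<noteq> 0"
  proof
    assume "t = 0"
    then have "?q $ 2 = - b" using t(4) by simp
    then show False using z(4) t(1) by linarith
  qed
  ultimately show thesis using that[of z b t] z t by simp
qed

lemma is_turn_forward:
  assumes "a > 0"
  obtains z b z' where "is_turn a z b z'"
proof -
  obtain z b z' where "0 < z" "z \<le> pi" "b > 0" "0 < z'" "z' \<le> pi"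
    "a *\<^sub>R E g z = b *\<^sub>R E (- g) z'" "H n g (a *\<^sub>R E g z) = 0"
    by (rule crossing_in_other_flow[OF assms, of g "- g"]) (rule disjI1[OF refl], rule that)
  then show thesis using that[of z b z'] assms unfolding is_turn_def by blast
qed

text \<open>Both flows cross the curve in the same way, so the construction can start from the G^-
  arc and look up the G^+ arc through its crossing point.\<close>

lemma is_turn_backward:
  assumes "b > 0"
  obtains a z z' where "is_turn a z b z'"
proof -
  obtain z' a z where "0 < z'" "z' \<le> pi" "a > 0" "0 < z" "z \<le> pi"
    "b *\<^sub>R E (- g) z' = a *\<^sub>R E g z" "H n g (b *\<^sub>R E (- g) z') = 0"
    by (rule crossing_in_other_flow[OF assms, of "- g" g]) (rule disjI2[OF refl], rule that)
  then show thesis using that[of a z z'] assms unfolding is_turn_def by metis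
qed

lemma continuous_on_turn:
  assumes "is_turn a z b z'"
  shows "continuous_on S (\<lambda>t. turn a z b z' (t - d))"
proof -
  have "continuous_on ({..z} \<union> {z..}) (turn a z b z')"
    unfolding turn_def
  proof (intro continuous_on_cases closed_atMost closed_atLeast)
    show "continuous_on {..z} (\<lambda>t. a *\<^sub>R E g t)"
      "continuous_on {z..} (\<lambda>t. b *\<^sub>R E (- g) (t - (z - z')))" by (intro continuous_intros)+
    have "a *\<^sub>R E g z = b *\<^sub>R E (- g) (z - (z - z'))" using is_turnD(7)[OF assms] by simp
    moreover have "t = z" if "t \<in> {..z} \<and> \<not> t \<le> z \<or> t \<in> {z..} \<and> t \<le> z" for t
      using that by auto
    ultimately show "\<forall>t. t \<in> {..z} \<and> \<not> t \<le> z \<or> t \<in> {z..} \<and> t \<le> z \<longrightarrow>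
        a *\<^sub>R E g t = b *\<^sub>R E (- g) (t - (z - z'))" by blast
  qed
  moreover have "{..z} \<union> {z..} = UNIV" by auto
  ultimately have "continuous_on UNIV (turn a z b z')" by simp
  then show ?thesis
    by (rule continuous_on_compose2) (auto intro!: continuous_intros)
qed

lemma E_nonzero: "E s t \<noteq> 0"
proof
  assume "E s t = 0"
  then have "E s t $ 1 = 0" "E s t $ 2 = 0" by simp_all
  then show False using sin_zero_abs_cos_one[of t] by simp
qed

text \<open>A turn lasts Z + 2 pi - Z' >= pi, so the joints do not accumulate. H is positive on the
  first arc and negative on the second, hence vanishes only at the joints, with a change of sign at
  each.\<close>

lemma concatenate_turns:
  fixes A Z B Z' T :: "int \<Rightarrow> real"
  assumes turns: "\<And>k. is_turn (A k) (Z k) (B k) (Z' k)"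
    and link: "\<And>k. A (k + 1) = B k * exp (- g * (2 * pi))"
    and time: "\<And>k. T (k + 1) = T k + (Z k + 2 * pi - Z' k)"
  obtains X where "pw_solution n g X"
    "\<And>k t. \<lbrakk>T k \<le> t; t \<le> T (k + 1)\<rbrakk> \<Longrightarrow> X t = turn (A k) (Z k) (B k) (Z' k) (t - T k)"
proof -
  define Y where "Y k t = turn (A k) (Z k) (B k) (Z' k) (t - T k)" for k t
  have Zb: "0 < Z k" "Z k \<le> pi" "0 < Z' k" "Z' k \<le> pi" and AB: "A k > 0" "B k > 0" for k
    using is_turnD[OF turns[of k]] by simp_all
  have step: "T (k + 1) \<ge> T k + pi" for k
    using time[of k] Zb[of k] by simp
  have mid: "T k < T k + Z k" "T k + Z k < T (k + 1)" for k
    using time[of k] Zb[of k] by simp_all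
  have T_mono: "T k \<le> T j" if "k \<le> j" for k j
    using that
  proof (induction rule: int_ge_induct)
    case (step j)
    then show ?case using \<open>\<And>k. T (k + 1) \<ge> T k + pi\<close>[of j] pi_gt_zero by linarith
  qed simp
  have Y_start: "Y k (T k) = A k *\<^sub>R E g 0" for k
    using Zb[of k] by (simp add: Y_def turn_def)
  have Y_end: "Y k (T (k + 1)) = Y (k + 1) (T (k + 1))" for k
  proof -
    have "Y k (T (k + 1)) = B k *\<^sub>R E (- g) (2 * pi)"
      using Zb[of k] by (simp add: Y_def turn_def time[of k])
    \<comment> \<open>\<open>E (- g) (2 * pi)\<close> is (0, - exp (- 2 pi g)) and
      \<open>E g 0\<close> is (0, - 1); the factor in \<open>link\<close> compares them.\<close>
    also have "\<dots> = (B k * exp (- g * (2 * pi))) *\<^sub>R E g 0"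
      by (simp add: vec_eq_iff forall_2)
    finally show ?thesis by (simp only: Y_start link)
  qed
  define K where "K t = (SOME k. T k \<le> t \<and> t < T (k + 1))" for t
  have K: "T (K t) \<le> t" "t < T (K t + 1)" for t
    using int_partition_cover[of T pi t, OF step pi_gt_zero] someI_ex[of "\<lambda>k. T k \<le> t \<and> t < T (k + 1)"]
    unfolding K_def by blast+
  define X where "X t = Y (K t) t" for t
  have X: "X t = Y k t" if t: "T k \<le> t" "t \<le> T (k + 1)" for k t
  proof -
    have "\<not> K t + 1 \<le> k" using T_mono[of "K t + 1" k] K[of t] t by auto
    moreover have "\<not> k + 2 \<le> K t"
    proof -
      have "T (k + 2) \<ge> T (k + 1) + pi" using step[of "k + 1"] by (simp only: add.assoc one_add_one)
      then show ?thesis using T_mono[of "k + 2" "K t"] K[of t] t pi_gt_zero by auto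
    qed
    moreover have "t = T (k + 1)" if "K t = k + 1" using K[of t] t that by simp
    ultimately have "K t = k \<or> K t = k + 1 \<and> t = T (k + 1)" by linarith
    then show ?thesis using Y_end[of k] by (auto simp: X_def)
  qed
  have first: "X t = A k *\<^sub>R E g (t - T k)" if "T k \<le> t" "t \<le> T k + Z k" for k t
    using X[of k t] that mid[of k] by (simp add: Y_def turn_def)
  have second: "X t = B k *\<^sub>R E (- g) (t - (T k + (Z k - Z' k)))" if "T k + Z k < t" "t \<le> T (k + 1)" for k t
    using X[of k t] that mid[of k] by (simp add: Y_def turn_def diff_diff_eq)
  have Hfirst: "H n g (X t) > 0" if "T k < t" "t < T k + Z k" for k t
    using is_turn_sides(1)[OF turns[of k], of "t - T k"] first[of k t] that by simp
  have Hsecond: "H n g (X t) < 0" if "T k + Z k < t" "t < T (k + 1)" for k t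
    using is_turn_sides(2)[OF turns[of k], of "t - (T k + (Z k - Z' k))"] second[of k t] that time[of k] by simp
  have nz: "X t \<noteq> 0" for t
    using first[of "K t" t] second[of "K t" t] K[of t] AB[of "K t"] E_nonzero
    by (cases "t \<le> T (K t) + Z (K t)") auto
  have cont: "continuous_on {T k..T (k + 1)} X" for k
    using continuous_on_turn[OF turns[of k], of "{T k..T (k + 1)}" "T k"] X[of k]
    by (simp add: Y_def cong: continuous_on_cong_simp)
  have "isCont X t" for t
  proof -
    \<comment> \<open>Two adjacent intervals are joined so that \<open>t\<close> is interior even
      when it is a joint.\<close>
    let ?k = "K t - 1"
    have "continuous_on ({T ?k..T (?k + 1)} \<union> {T (?k + 1)..T (?k + 1 + 1)}) X"
      by (intro continuous_on_closed_Un cont) auto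
    moreover have "t \<in> interior ({T ?k..T (?k + 1)} \<union> {T (?k + 1)..T (?k + 1 + 1)})"
    proof (rule interiorI)
      have "T ?k + pi \<le> T (K t)" using step[of ?k] by simp
      then have "T ?k < t" using K(1)[of t] pi_gt_zero by linarith
      then show "t \<in> {T ?k<..<T (?k + 1 + 1)}" using K(2)[of t] by simp
    qed auto
    ultimately show ?thesis by (rule continuous_on_interior)
  qed
  then have "continuous_on UNIV X" by (simp add: continuous_at_imp_continuous_on)
  moreover have "(X has_vector_derivative pw_field n g (X t)) (at t)"
    if "H n g (X t) \<noteq> 0" for t
  proof -
    let ?k = "K t"
    consider "t = T ?k" | "T ?k < t" "t < T ?k + Z ?k" | "t = T ?k + Z ?k"
      | "T ?k + Z ?k < t" "t < T (?k + 1)" using K[of t] by linarith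
    then show ?thesis
    proof cases
      case 1
      then have "H n g (X t) = 0" using first[of ?k t] mid[of ?k] AB[of ?k] by (simp add: H_def)
      then show ?thesis using that by simp
    next
      case 2
      have "(X has_vector_derivative field g (A ?k *\<^sub>R E g (t - T ?k))) (at t)"
        by (rule has_vector_derivative_transform_within_open[OF E_has_derivative, where S = "{T ?k<..<T ?k + Z ?k}"])
           (use 2 in \<open>simp_all add: first[of ?k]\<close>)
      then show ?thesis using first[of ?k t] Hfirst[OF 2] 2 by (simp add: pw_field_eq)
    next
      case 3
      then have "H n g (X t) = 0"
      proof -
        have "t - T ?k = Z ?k" using 3 by linarith
        have "X t = A ?k *\<^sub>R E g (Z ?k)"
          by (rule first[of ?k t, unfolded \<open>t - T ?k = Z ?k\<close>]) (use K(1)[of t] 3 in simp_all)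
        then show ?thesis using is_turnD(8)[OF turns[of ?k]] by simp
      qed
      then show ?thesis using that by simp
    next
      case 4
      have "(X has_vector_derivative field (- g) (B ?k *\<^sub>R E (- g) (t - (T ?k + (Z ?k - Z' ?k))))) (at t)"
        by (rule has_vector_derivative_transform_within_open[OF E_has_derivative, where S = "{T ?k + Z ?k<..<T (?k + 1)}"])
           (use 4 in \<open>simp_all add: second[of ?k]\<close>)
      then show ?thesis using second[of ?k t] Hsecond[OF 4] 4 by (simp add: pw_field_eq)
    qed
  qed
  moreover have "crosses (\<lambda>s. H n g (X s)) t" if "H n g (X t) = 0" for t
  proof -
    let ?k = "K t"
    have "t = T ?k \<or> t = T ?k + Z ?k"
    proof (rule ccontr)
      assume n: "\<not> (t = T ?k \<or> t = T ?k + Z ?k)"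
      then have "T ?k < t" using K(1)[of t] by auto
      then show False
        using Hfirst[of ?k t] Hsecond[of ?k t] that K(2)[of t] n by (cases "t < T ?k + Z ?k") auto
    qed
    then consider "t = T ?k" | "t = T ?k + Z ?k" by blast
    then show ?thesis
    proof cases
      case 1
      let ?j = "?k - 1"
      define e where "e = min (T (?j + 1) - (T ?j + Z ?j)) (Z ?k)"
      have "e > 0" using mid[of ?j] mid[of ?k] by (simp add: e_def)
      moreover have "H n g (X s) < 0" if "t - e < s" "s < t" for s
        using that 1 by (intro Hsecond[of ?j]) (auto simp: e_def)
      moreover have "H n g (X s) > 0" if "t < s" "s < t + e" for s
        using that 1 by (intro Hfirst[of ?k]) (auto simp: e_def)
      ultimately show ?thesis unfolding crosses_def by (intro exI[of _ e]) simp
    next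
      case 2
      define e where "e = min (T (?k + 1) - (T ?k + Z ?k)) (Z ?k)"
      have "e > 0" using mid[of ?k] by (simp add: e_def)
      moreover have "H n g (X s) > 0" if "t - e < s" "s < t" for s
        using that 2 by (intro Hfirst[of ?k]) (auto simp: e_def)
      moreover have "H n g (X s) < 0" if "t < s" "s < t + e" for s
        using that 2 by (intro Hsecond[of ?k]) (auto simp: e_def)
      ultimately show ?thesis unfolding crosses_def by (intro exI[of _ e]) simp
    qed
  qed
  ultimately have "pw_solution n g X" using nz by (simp add: pw_solution_def)
  then show thesis using that X by (simp add: Y_def)
qed

text \<open>The chain runs over pairs of a depth a, for a start at (0, - a), and a starting time, so
  that switching points and switching times are built together.\<close>

lemma solution_through_turn_start:
  assumes "a > 0"
  obtains X A T Z B Z' where "pw_solution n g X" "A 0 = a" "T 0 = t0"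
    "\<And>k::int. is_turn (A k) (Z k) (B k) (Z' k)"
    "\<And>k. A (k + 1) = B k * exp (- g * (2 * pi))"
    "\<And>k. T (k + 1) = T k + (Z k + 2 * pi - Z' k)"
    "\<And>k t. \<lbrakk>T k \<le> t; t \<le> T (k + 1)\<rbrakk> \<Longrightarrow> X t = turn (A k) (Z k) (B k) (Z' k) (t - T k)"
proof -
  define R where "R p q \<longleftrightarrow> (\<exists>z b z'. is_turn (fst p) z b z' \<and> fst q = b * exp (- g * (2 * pi)) \<and>
      snd q = snd p + (z + 2 * pi - z'))" for p q :: "real \<times> real"
  have fwd: "\<exists>q. fst q > 0 \<and> R p q" if p: "fst p > 0" for p
  proof -
    obtain z b z' where *: "is_turn (fst p) z b z'" using is_turn_forward[OF p] .
    then have "b > 0" by (simp add: is_turn_def)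
    then show ?thesis
      using * by (intro exI[of _ "(b * exp (- g * (2 * pi)), snd p + (z + 2 * pi - z'))"]) (auto simp: R_def)
  qed
  have bwd: "\<exists>q. fst q > 0 \<and> R q p" if p: "fst p > 0" for p
  proof -
    have "fst p * exp (g * (2 * pi)) > 0" using p by simp
    then obtain a z z' where *: "is_turn a z (fst p * exp (g * (2 * pi))) z'" by (rule is_turn_backward)
    moreover have "fst p = fst p * exp (g * (2 * pi)) * exp (- g * (2 * pi))"
      by (simp add: mult.assoc exp_add[symmetric])
    ultimately have "R (a, snd p - (z + 2 * pi - z')) p"
      unfolding R_def by (intro exI[of _ z] exI[of _ "fst p * exp (g * (2 * pi))"] exI[of _ z']) simp
    then show ?thesis using * by (intro exI[of _ "(a, snd p - (z + 2 * pi - z'))"]) (simp add: is_turn_def)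
  qed
  obtain S :: "int \<Rightarrow> real \<times> real" where S: "S 0 = (a, t0)" "\<And>k. R (S k) (S (k + 1))"
    by (rule int_chain[of "\<lambda>p. fst p > 0" R "(a, t0)", OF fwd bwd]) (use assms in auto)
  have "\<forall>k. \<exists>z b z'. is_turn (fst (S k)) z b z' \<and> fst (S (k + 1)) = b * exp (- g * (2 * pi)) \<and>
      snd (S (k + 1)) = snd (S k) + (z + 2 * pi - z')"
    using S(2) unfolding R_def by blast
  then obtain Z B Z' where *: "\<And>k. is_turn (fst (S k)) (Z k) (B k) (Z' k)"
    "\<And>k. fst (S (k + 1)) = B k * exp (- g * (2 * pi))"
    "\<And>k. snd (S (k + 1)) = snd (S k) + (Z k + 2 * pi - Z' k)"
    by metis
  obtain X where "pw_solution n g X" "\<And>k t. \<lbrakk>snd (S k) \<le> t; t \<le> snd (S (k + 1))\<rbrakk> \<Longrightarrow>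
      X t = turn (fst (S k)) (Z k) (B k) (Z' k) (t - snd (S k))"
    using concatenate_turns[where T = "\<lambda>k. snd (S k)", OF *] by blast
  with S(1) * show thesis
    by (intro that[of X "\<lambda>k. fst (S k)" "\<lambda>k. snd (S k)" Z B Z']) auto
qed

text \<open>If H p >= 0, then p lies on the first arc of a turn, which is made to start at time - t.
  If H p < 0, then p lies on the second arc; the chain is anchored at the start of the next turn, at
  time 2 pi - t, and p is met in turn -1.\<close>

lemma solution_exists:
  assumes "p \<noteq> 0"
  obtains X where "pw_solution n g X" "X 0 = p"
proof (cases "H n g p < 0")
  case False
  obtain a t where t: "a > 0" "0 \<le> t" "t < 2 * pi" "p = a *\<^sub>R E g t"
    using polar_E[OF assms] by blast
  obtain X A T Z B Z' where X: "pw_solution n g X" "A 0 = a" "T 0 = - t"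
    "\<And>k::int. is_turn (A k) (Z k) (B k) (Z' k)"
    "\<And>k. A (k + 1) = B k * exp (- g * (2 * pi))"
    "\<And>k. T (k + 1) = T k + (Z k + 2 * pi - Z' k)"
    "\<And>k t. \<lbrakk>T k \<le> t; t \<le> T (k + 1)\<rbrakk> \<Longrightarrow> X t = turn (A k) (Z k) (B k) (Z' k) (t - T k)"
    by (rule solution_through_turn_start[OF t(1), of "- t"]) (rule that)
  have *: "is_turn a (Z 0) (B 0) (Z' 0)" using X(4)[of 0] X(2) by simp
  then have "\<not> Z 0 < t"
    using crossing_unique(2)[of a g "Z 0" t] t False is_turnD[OF *] by auto
  moreover have "Z' 0 \<le> pi" using * by (simp add: is_turn_def)
  ultimately have "X 0 = p"
    using X(7)[of 0 0] X(2,3) X(6)[of 0] t by (simp add: turn_def)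
  then show thesis using that X(1) by blast
next
  case True
  obtain b t where t: "b > 0" "0 \<le> t" "t < 2 * pi" "p = b *\<^sub>R E (- g) t"
    using polar_E[OF assms] by blast
  have "b * exp (- g * (2 * pi)) > 0" using t by simp
  then obtain X A T Z B Z' where X: "pw_solution n g X" "A 0 = b * exp (- g * (2 * pi))" "T 0 = 2 * pi - t"
    "\<And>k::int. is_turn (A k) (Z k) (B k) (Z' k)"
    "\<And>k. A (k + 1) = B k * exp (- g * (2 * pi))"
    "\<And>k. T (k + 1) = T k + (Z k + 2 * pi - Z' k)"
    "\<And>k t. \<lbrakk>T k \<le> t; t \<le> T (k + 1)\<rbrakk> \<Longrightarrow> X t = turn (A k) (Z k) (B k) (Z' k) (t - T k)"
    by (rule solution_through_turn_start[of _ "2 * pi - t"]) (rule that)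
  have "B (- 1) = b" using X(2) X(5)[of "- 1"] by simp
  then have *: "is_turn (A (- 1)) (Z (- 1)) b (Z' (- 1))" using X(4)[of "- 1"] by simp
  have "t \<noteq> 0" using True t by (auto simp: H_def)
  have "Z' (- 1) < t"
  proof (rule ccontr)
    assume "\<not> Z' (- 1) < t"
    moreover have "H n g p = 0" if "t = Z' (- 1)" using is_turnD(9)[OF *] that t(4) by simp
    ultimately have "t < Z' (- 1)" "t > 0" using True t(2) \<open>t \<noteq> 0\<close> by force+
    then have "H n g (b *\<^sub>R E (- g) t) > 0"
      using is_turnD[OF *] by (intro crossing_unique(1)[of b "- g" "Z' (- 1)"]) auto
    then show False using True t(4) by simp
  qed
  moreover have T: "T (- 1) = 2 * pi - t - (Z (- 1) + 2 * pi - Z' (- 1))" using X(3) X(6)[of "- 1"] by simp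
  moreover have "Z (- 1) > 0" using * by (simp add: is_turn_def)
  ultimately have "X 0 = turn (A (- 1)) (Z (- 1)) b (Z' (- 1)) (0 - T (- 1))"
    using X(7)[of "- 1" 0] X(3) t(3) \<open>B (- 1) = b\<close> by simp
  also have "\<dots> = p" using \<open>Z' (- 1) < t\<close> by (simp add: T turn_def t(4))
  finally show thesis using that X(1) by blast
qed

end

section \<open>Level sets of the gauge\<close>

lemma antimono_tendsto_at_top:
  fixes f :: "real \<Rightarrow> real"
  assumes mono: "\<And>s t. s \<le> t \<Longrightarrow> f t \<le> f s" and bd: "\<And>t. b \<le> f t"
  obtains l where "b \<le> l" "\<And>t. l \<le> f t" "(f \<longlongrightarrow> l) at_top"
proof -
  define l where "l = (INF t. f t)"
  have bdd: "bdd_below (range f)" using bd by (auto intro: bdd_belowI[of _ b])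
  have le: "l \<le> f t" for t unfolding l_def using bdd by (rule cINF_lower) simp
  have "b \<le> l" unfolding l_def using bd by (intro cINF_greatest) auto
  moreover have "(f \<longlongrightarrow> l) at_top"
  proof (rule order_tendstoI)
    fix a assume "a < l"
    then show "\<forall>\<^sub>F t in at_top. a < f t" using le less_le_trans by (intro always_eventually) blast
  next
    fix a assume "l < a"
    then obtain s where "f s < a" unfolding l_def using bdd by (auto simp: cINF_less_iff)
    then have "\<forall>t\<ge>s. f t < a" using mono le_less_trans by blast
    then show "\<forall>\<^sub>F t in at_top. f t < a" unfolding eventually_at_top_linorder by blast
  qed
  ultimately show thesis using le that by blast
qed

lemma antimono_tendsto_at_bot:
  fixes f :: "real \<Rightarrow> real"
  assumes mono: "\<And>s t. s \<le> t \<Longrightarrow> f t \<le> f s" and bd: "\<And>t. f t \<le> b"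
  obtains l where "l \<le> b" "\<And>t. f t \<le> l" "(f \<longlongrightarrow> l) at_bot"
proof -
  obtain l where l: "- b \<le> l" "\<And>t. l \<le> - f (- t)" "((\<lambda>t. - f (- t)) \<longlongrightarrow> l) at_top"
    by (rule antimono_tendsto_at_top[of "\<lambda>t. - f (- t)" "- b"]) (use mono bd in auto)
  have "((\<lambda>t. - (- f (- t))) \<longlongrightarrow> - l) at_top" using l(3) by (rule tendsto_minus)
  then have "(f \<longlongrightarrow> - l) at_bot" by (simp add: filterlim_at_bot_mirror)
  moreover have "f t \<le> - l" for t using l(2)[of "- t"] by simp
  ultimately show thesis using that[of "- l"] l(1) by simp
qed

context two_zone
begin

definition level :: "real \<Rightarrow> (real^2) set" where
  "level a = {p. N p = a}"

lemma radius_less_iff: "radius j < radius k \<longleftrightarrow> j < k"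
  and radius_inj: "radius j = radius k \<longleftrightarrow> j = k"
  by (simp_all add: radius_def)

lemma radius_between: "\<lbrakk>radius (k - 1) < radius j; radius j \<le> radius k\<rbrakk> \<Longrightarrow> j = k"
  "\<lbrakk>radius j < radius (k + 1); radius k \<le> radius j\<rbrakk> \<Longrightarrow> j = k"
  using radius_less_iff[of "k - 1" j] radius_less_iff[of k j] radius_less_iff[of j "k + 1"]
    radius_less_iff[of j k] by linarith+

definition C :: real where "C = (2 + g) * exp (g * pi)"

lemma C_pos: "C > 0"
  using g0 by (simp add: C_def)

text \<open>The radial projection (a / N p) p lies on the level set by homogeneity, and its distance
  to p is controlled by comparing the norm with \<open>N\<close>.\<close>

lemma infdist_level:
  assumes "p \<noteq> 0" "a > 0"
  shows "infdist p (level a) \<le> C * \<bar>N p - a\<bar>"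
proof -
  have Np: "N p > 0" using assms(1) by (simp add: N_pos_iff)
  let ?q = "(a / N p) *\<^sub>R p"
  have "?q \<in> level a" using Np assms(2) by (simp add: level_def N_scaleR)
  then have "infdist p (level a) \<le> dist p ?q" by (rule infdist_le)
  also have "\<dots> = norm ((1 - a / N p) *\<^sub>R p)" by (simp add: dist_norm algebra_simps)
  also have "\<dots> = \<bar>N p - a\<bar> / N p * norm p"
    using Np by (simp add: diff_divide_distrib[symmetric] abs_divide[symmetric] divide_simps)
  also have "\<dots> \<le> \<bar>N p - a\<bar> / N p * (C * N p)"
    using norm_le_N[of p] Np by (intro mult_left_mono) (auto simp: C_def)
  also have "\<dots> = C * \<bar>N p - a\<bar>" using Np by simp
  finally show ?thesis .
qed

lemma level_nonempty:
  assumes "a > 0"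
  shows "level a \<noteq> {}"
proof -
  have "N (V 1) = 1" using N_polar[of 1 "V 1" 0] by simp
  then have "a *\<^sub>R V 1 \<in> level a" using assms by (simp add: level_def N_scaleR)
  then show ?thesis by blast
qed

lemma compact_level: "compact (level a)"
proof -
  have "closed (level a)"
    unfolding level_def using continuous_on_N by (intro closed_Collect_eq) auto
  moreover have "norm p \<le> C * a" if "p \<in> level a" for p
    using norm_le_N[of p] that by (simp add: level_def C_def)
  then have "bounded (level a)" unfolding bounded_iff by blast
  ultimately show ?thesis by (simp add: compact_eq_bounded_closed)
qed

text \<open>By the intermediate value theorem the component of p cannot leave the sublevel set,
  which is bounded.\<close>

lemma inside_level_if:
  assumes "N p < a"
  shows "p \<in> inside (level a)"
proof -
  let ?K = "connected_component_set (- level a) p"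
  have p: "p \<in> - level a" using assms by (simp add: level_def)
  have "N q < a" if q: "q \<in> ?K" for q
  proof (rule ccontr)
    assume "\<not> N q < a"
    have "connected (N ` ?K)"
      using continuous_on_N continuous_on_subset by (intro connected_continuous_image) auto
    moreover have "N p \<in> N ` ?K" "N q \<in> N ` ?K" using p q by (auto simp: connected_component_refl)
    ultimately have "a \<in> N ` ?K"
      using assms \<open>\<not> N q < a\<close> connectedD_interval[of "N ` ?K" "N p" "N q" a] by auto
    then obtain r where "r \<in> ?K" "N r = a" by auto
    then show False using connected_component_subset[of "- level a" p] by (auto simp: level_def)
  qed
  then have "norm q \<le> C * a" if "q \<in> ?K" for q
    using that norm_le_N[of q] C_pos mult_left_mono[of "N q" a C] unfolding C_def by force
  then have "bounded ?K" unfolding bounded_iff by blast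
  then show ?thesis using p by (simp add: inside_def)
qed

text \<open>\<open>N\<close> grows along the ray from p away from the origin, so this unbounded ray
  stays in the component of p.\<close>

lemma outside_level_if:
  assumes "N p > a" "a > 0"
  shows "p \<in> outside (level a)"
proof -
  let ?K = "connected_component_set (- level a) p" and ?R = "(\<lambda>l. l *\<^sub>R p) ` {1..}"
  have Np: "N p > 0" using assms by simp
  then have p: "p \<noteq> 0" by (simp add: N_pos_iff)
  have "connected ?R" by (intro connected_continuous_image continuous_intros) auto
  moreover have "p \<in> ?R" by (auto intro: image_eqI[of _ _ 1])
  moreover have "?R \<subseteq> - level a"
  proof -
    have "N (l *\<^sub>R p) > a" if "l \<ge> 1" for l
    proof -
      have "1 * N p \<le> l * N p" using that Np by (intro mult_right_mono) auto
      then show ?thesis using that assms(1) N_scaleR[of l p] by linarith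
    qed
    then show ?thesis by (force simp: level_def)
  qed
  ultimately have "?R \<subseteq> ?K" by (intro connected_component_maximal)
  moreover have "\<not> bounded ?R"
  proof
    assume "bounded ?R"
    then obtain B where B: "\<And>l. l \<ge> 1 \<Longrightarrow> norm (l *\<^sub>R p) \<le> B" unfolding bounded_iff by auto
    obtain m where "real m * norm p > B" using reals_Archimedean3[of "norm p"] p by auto
    then have "(1 + real m) * norm p > B" using p by (simp add: distrib_right add_pos_pos)
       (smt (verit) norm_ge_zero)
    then show False using B[of "1 + real m"] by simp
  qed
  ultimately have "\<not> bounded ?K" using bounded_subset by blast
  then show ?thesis unfolding outside by simp
qed

lemma inside_level:
  assumes "a > 0"
  shows "inside (level a) = {p. N p < a}" and outside_level: "outside (level a) = {p. N p > a}"
proof -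
  have "inside (level a) \<inter> outside (level a) = {}" "inside (level a) \<inter> level a = {}"
    "outside (level a) \<inter> level a = {}"
    by (simp_all add: inside_Int_outside inside_no_overlap outside_no_overlap)
  then show "inside (level a) = {p. N p < a}" "outside (level a) = {p. N p > a}"
    using inside_level_if[of _ a] outside_level_if[of a] assms linorder_neqE_linordered_idom[of _ a]
    unfolding level_def by blast+
qed

text \<open>Near the level set the neighbouring radii are excluded as limits. For k = 1 the lower
  bound is \<open>radius 0 = 0\<close>, which keeps the origin away.\<close>

lemma level_neighbourhood:
  assumes "k \<in> {1..n}"
  obtains e where "e > 0" "\<And>p. infdist p (level (radius k)) < e \<Longrightarrow> radius (k - 1) < N p \<and> N p < radius (k + 1)"
proof -
  have "open {p. radius (k - 1) < N p}" "open {p. N p < radius (k + 1)}"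
    using continuous_on_N by (auto intro!: open_Collect_less)
  then have "open ({p. radius (k - 1) < N p} \<inter> {p. N p < radius (k + 1)})" by (rule open_Int)
  moreover have "level (radius k) \<subseteq> {p. radius (k - 1) < N p} \<inter> {p. N p < radius (k + 1)}"
    using assms by (auto simp: level_def radius_less_iff)
  ultimately obtain e where "e > 0" "{x. infdist x (level (radius k)) \<le> e}
      \<subseteq> {p. radius (k - 1) < N p} \<inter> {p. N p < radius (k + 1)}"
    by (rule compact_in_open_separated[OF level_nonempty[OF radius_pos[OF assms]] compact_level])
  then have "radius (k - 1) < N p \<and> N p < radius (k + 1)"
    if "infdist p (level (radius k)) < e" for p
    using less_imp_le[OF that] by blast
  with \<open>e > 0\<close> show thesis by (rule that)
qed

lemma level_Int_axis:
  assumes "k \<in> {1..n}"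
  shows "level (radius k) \<inter> {p. p $ 1 = 0} =
    {vector [0, 2 * real k], vector [0, - 2 * real k * exp (- pi * g)]}"
proof -
  have top: "N p = p $ 2 * exp (- g * pi)" if "p $ 1 = 0" "p $ 2 > 0" for p
  proof -
    have "W p = of_real (p $ 2) * cis pi" using that by (simp add: complex_eq_iff)
    from N_polar[OF that(2) this] show ?thesis by simp
  qed
  have bot: "N p = - p $ 2" if "p $ 1 = 0" "p $ 2 < 0" for p
  proof -
    have "W p = of_real (- p $ 2) * cis 0" using that by (simp add: complex_eq_iff)
    from N_polar[OF _ this] show ?thesis using that by simp
  qed
  have r: "radius k = 2 * real k * exp (- pi * g)" by (simp add: radius_def mult.commute)
  have k: "real k > 0" using assms by simp
  show ?thesis
  proof (intro equalityI subsetI)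
    fix p assume "p \<in> level (radius k) \<inter> {p. p $ 1 = 0}"
    then have p: "N p = radius k" "p $ 1 = 0" by (auto simp: level_def)
    then have "p $ 2 \<noteq> 0" using N_pos_iff[of p] radius_pos[OF assms] by (auto simp: vec_eq_iff forall_2)
    then consider "p $ 2 > 0" | "p $ 2 < 0" by linarith
    then show "p \<in> {vector [0, 2 * real k], vector [0, - 2 * real k * exp (- pi * g)]}"
    proof cases
      case 1
      then have "p $ 2 = 2 * real k" using top[OF p(2) 1] p(1) by (simp add: radius_def)
      then show ?thesis using p(2) by (simp add: vec_eq_iff forall_2)
    next
      case 2
      then have "p $ 2 = - 2 * real k * exp (- pi * g)" using bot[OF p(2) 2] p(1) r by simp
      then show ?thesis using p(2) by (simp add: vec_eq_iff forall_2)
    qed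
  next
    fix p :: "real^2" assume "p \<in> {vector [0, 2 * real k], vector [0, - 2 * real k * exp (- pi * g)]}"
    then consider "p = vector [0, 2 * real k]" | "p = vector [0, - 2 * real k * exp (- pi * g)]" by blast
    then show "p \<in> level (radius k) \<inter> {p. p $ 1 = 0}"
    proof cases
      case 1
      then have p: "p $ 1 = 0" "p $ 2 = 2 * real k" by simp_all
      then show ?thesis using top[of p] k by (simp add: level_def radius_def)
    next
      case 2
      then have p: "p $ 1 = 0" "p $ 2 = - radius k" by (simp_all add: r)
      then show ?thesis using bot[of p] radius_pos[OF assms] by (simp add: level_def)
    qed
  qed
qed

section \<open>Periodic orbits and limit cycles\<close>

context
  fixes X th f
  assumes lift: "polar_lift X th f"
begin

lemma limit_radius_at_top:
  assumes "(f \<longlongrightarrow> l) at_top"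
  obtains k where "k \<in> {1..n}" "exp l = radius k"
proof (rule limit_radius[OF lift])
  fix e :: real assume "e > 0"
  then have "\<forall>\<^sub>F t in at_top. dist (f t) l < e" using assms tendstoD by blast
  then obtain u where "\<And>t. t \<ge> u \<Longrightarrow> dist (f t) l < e" unfolding eventually_at_top_linorder by blast
  then show "\<exists>u. \<forall>t\<in>{u..u + 4 * pi}. \<bar>f t - l\<bar> < e"
    by (intro exI[of _ u]) (auto simp: dist_real_def)
qed (rule that)

lemma limit_radius_at_bot:
  assumes "(f \<longlongrightarrow> l) at_bot"
  obtains k where "k \<in> {1..n}" "exp l = radius k"
proof (rule limit_radius[OF lift])
  fix e :: real assume "e > 0"
  then have "\<forall>\<^sub>F t in at_bot. dist (f t) l < e" using assms tendstoD by blast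
  then obtain u where "\<And>t. t \<le> u \<Longrightarrow> dist (f t) l < e" unfolding eventually_at_bot_linorder by blast
  then show "\<exists>u. \<forall>t\<in>{u..u + 4 * pi}. \<bar>f t - l\<bar> < e"
    by (intro exI[of _ "u - 4 * pi"]) (auto simp: dist_real_def)
qed (rule that)

text \<open>The angle increases without bound, hence takes every value modulo 2 pi, and a point is
  determined by its gauge and its angle.\<close>

lemma constant_radius_range:
  assumes "\<And>t. N (X t) = a"
  shows "range X = level a"
proof
  show "range X \<subseteq> level a" using assms by (auto simp: level_def)
  show "level a \<subseteq> range X"
  proof
    fix p assume p: "p \<in> level a"
    have "N (X 0) > 0" using lift_nonzero[OF lift] by (simp add: N_pos_iff)
    then have "a > 0" using assms by simp
    then have "p \<noteq> 0" using p by (auto simp: level_def)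
    then obtain r s where rs: "r > 0" "W p = of_real r * cis s" by (rule polar_form)
    define j where "j = \<lceil>(th 0 - s) / (2 * pi)\<rceil>"
    have "(th 0 - s) / (2 * pi) \<le> j" unfolding j_def by linarith
    then have j: "th 0 \<le> s + 2 * pi * j" by (simp add: field_simps)
    let ?u = "s + 2 * pi * j - th 0"
    have "s + 2 * pi * j \<le> th ?u" using th_expanding[OF lift, of 0 ?u] j by simp
    then obtain t where t: "th t = s + 2 * pi * j"
      using IVT'[of th 0 "s + 2 * pi * j" ?u] j th_continuous[OF lift] by auto
    have per: "sin (th t) = sin s" "cos (th t) = cos s"
      using sin_cos_eq_iff[of "th t" s] t by (auto simp: mult_ac)
    then have cis: "cis (th t) = cis s" by (simp add: complex_eq_iff)
    have "N (X t) = N p" using assms p by (simp add: level_def)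
    then have "exp (f t + g * arccos (cos (th t))) = r"
      using N_polar[OF _ lift_W[OF lift], of t] N_polar[OF rs] by (simp add: per)
    then have "W (X t) = W p" using lift_W[OF lift, of t] rs(2) cis by simp
    then show "p \<in> range X" using W_inj by blast
  qed
qed

end

text \<open>Along a periodic solution \<open>f\<close> is periodic and nonincreasing, hence
  constant, and is therefore its own limit.\<close>

lemma periodic_orbit_imp_level:
  assumes "periodic_orbit n g \<Gamma>"
  obtains k where "k \<in> {1..n}" "\<Gamma> = level (radius k)"
proof -
  obtain X T where X: "pw_solution n g X" "T > 0" "\<And>t. X (t + T) = X t"
    "\<not> (\<exists>p. \<forall>t. X t = p)" "\<Gamma> = range X"
    using assms unfolding periodic_orbit_def by blast
  obtain s where "X s \<noteq> 0" using X(4) by metis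
  then have "X 0 \<noteq> 0" using sol_nonzero[OF X(1)] by blast
  then obtain th f where lift: "polar_lift X th f" using polar_lift_exists[OF X(1)] by blast
  have per: "f (t + T) = f t" for t
    using lift_N[OF lift, of t] lift_N[OF lift, of "t + T"] X(3)[of t] by simp
  have perm: "f (t + real m * T) = f t" for t m
  proof (induction m)
    case (Suc m)
    then show ?case using per[of "t + real m * T"] by (simp add: algebra_simps)
  qed simp
  have "f s = f t" if "s \<le> t" for s t
  proof -
    obtain m where "real m * T > t - s" using reals_Archimedean3[OF X(2)] by blast
    then have "f (s + real m * T) \<le> f t" by (intro f_antimono[OF lift]) simp
    then show ?thesis using perm[of s m] f_antimono[OF lift that] by simp
  qed
  then have const: "f t = f 0" for t by (metis linear)
  obtain k where k: "k \<in> {1..n}" "exp (f 0) = radius k"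
  proof (rule limit_radius[OF lift, of "f 0"])
    show "\<exists>u. \<forall>t\<in>{u..u + 4 * pi}. \<bar>f t - f 0\<bar> < e" if "e > 0" for e
    proof -
      have "\<bar>f t - f 0\<bar> < e" for t using const[of t] that by simp
      then show ?thesis by blast
    qed
  qed (rule that)
  have "N (X t) = radius k" for t using lift_N[OF lift, of t] const[of t] k(2) by simp
  then have "\<Gamma> = level (radius k)" using constant_radius_range[OF lift] X(5) by simp
  then show thesis using k(1) that by blast
qed

lemma periodic_orbit_level:
  assumes k: "k \<in> {1..n}"
  shows "periodic_orbit n g (level (radius k))"
proof -
  \<comment> \<open>\<open>E (- g) pi\<close> is (0, exp (- g pi)), so this depth makes the G^- arc
    pass through (0, 2k) at parameter pi. It ends at (0, - radius k), which closes the turn.\<close>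
  let ?b = "2 * real k * exp (g * pi)"
  have k0: "real k > 0" using k by simp
  have "radius k *\<^sub>R E g pi = ?b *\<^sub>R E (- g) pi"
    by (simp add: vec_eq_iff forall_2 radius_top) (simp add: mult.assoc exp_add[symmetric])
  moreover have "H n g (radius k *\<^sub>R E g pi) = 0"
    using k h_eq_zero_iff[of "2 * real k"] by (auto simp: H_def radius_top)
  ultimately have turn: "is_turn (radius k) pi ?b pi"
    using radius_pos[OF k] k0 by (simp add: is_turn_def)
  define T where "T j = 2 * pi * real_of_int j" for j
  have link: "radius k = ?b * exp (- g * (2 * pi))"
    by (simp add: radius_def mult.assoc exp_add[symmetric])
  have Tstep: "T (j + 1) = T j + (pi + 2 * pi - pi)" for j by (simp add: T_def algebra_simps)
  obtain X where X: "pw_solution n g X"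
    "\<And>j t. \<lbrakk>T j \<le> t; t \<le> T (j + 1)\<rbrakk> \<Longrightarrow> X t = turn (radius k) pi ?b pi (t - T j)"
    by (rule concatenate_turns[of "\<lambda>_. radius k" "\<lambda>_. pi" "\<lambda>_. ?b" "\<lambda>_. pi" T, OF turn link Tstep])
       (rule that)
  have "X (t + 2 * pi) = X t" for t
  proof -
    obtain j where j: "T j \<le> t" "t < T (j + 1)"
      using int_partition_cover[of T "2 * pi" t] Tstep by auto
    then have "X t = turn (radius k) pi ?b pi (t - T j)" by (intro X(2)) auto
    moreover have "X (t + 2 * pi) = turn (radius k) pi ?b pi (t + 2 * pi - T (j + 1))"
      using j Tstep[of j] Tstep[of "j + 1"] by (intro X(2)) auto
    ultimately show ?thesis using Tstep[of j] by simp
  qed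
  moreover have X0: "X 0 = radius k *\<^sub>R E g 0" and "X pi = radius k *\<^sub>R E g pi"
    using X(2)[of 0 0] X(2)[of 0 pi] by (simp_all add: T_def turn_def)
  then have "X 0 $ 2 < 0" "X pi $ 2 > 0" using radius_pos[OF k] by simp_all
  then have "X 0 \<noteq> X pi" by auto
  then have "\<not> (\<exists>p. \<forall>t. X t = p)" by metis
  ultimately have per: "periodic_orbit n g (range X)"
    unfolding periodic_orbit_def using X(1) by (intro exI[of _ X] exI[of _ "2 * pi"]) auto
  \<comment> \<open>The orbit is some level set by the classification; its index is then read off
    from the starting point.\<close>
  then obtain j where j: "j \<in> {1..n}" "range X = level (radius j)" by (rule periodic_orbit_imp_level)
  have "W (X 0) = of_real (radius k) * cis 0"
    using W_E_right[of "radius k" 0] radius_pos[OF k] X0 by simp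
  from N_polar[OF radius_pos[OF k] this] have "N (X 0) = radius k" by simp
  moreover have "X 0 \<in> level (radius j)" using j(2) by blast
  ultimately have "radius j = radius k" by (simp add: level_def)
  then show ?thesis using per j(2) by simp
qed

text \<open>There are only finitely many periodic orbits, all compact, so the complement of the
  others isolates each one.\<close>

lemma limit_cycle_iff: "limit_cycle n g \<Gamma> \<longleftrightarrow> (\<exists>k\<in>{1..n}. \<Gamma> = level (radius k))"
proof
  assume "limit_cycle n g \<Gamma>"
  then have "periodic_orbit n g \<Gamma>" by (simp add: limit_cycle_def)
  then obtain k where "k \<in> {1..n}" "\<Gamma> = level (radius k)" by (rule periodic_orbit_imp_level)
  then show "\<exists>k\<in>{1..n}. \<Gamma> = level (radius k)" by (rule bexI[rotated])
next
  assume "\<exists>k\<in>{1..n}. \<Gamma> = level (radius k)"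
  then obtain k where k: "k \<in> {1..n}" "\<Gamma> = level (radius k)" by blast
  let ?U = "- (\<Union>j\<in>{1..n} - {k}. level (radius j))"
  have "open ?U" by (intro open_Compl closed_UN) (simp_all add: compact_imp_closed compact_level)
  moreover have "\<Gamma> \<subseteq> ?U" using k by (auto simp: level_def radius_inj)
  moreover have "\<Gamma>' = \<Gamma>" if \<Gamma>': "periodic_orbit n g \<Gamma>'" "\<Gamma>' \<subseteq> ?U" for \<Gamma>'
  proof -
    obtain j where j: "j \<in> {1..n}" "\<Gamma>' = level (radius j)" using \<Gamma>'(1) by (rule periodic_orbit_imp_level)
    then have "j = k" using \<Gamma>'(2) level_nonempty[OF radius_pos[OF j(1)]] by blast
    then show ?thesis using j k by simp
  qed
  ultimately show "limit_cycle n g \<Gamma>"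
    unfolding limit_cycle_def k(2) using periodic_orbit_level[OF k(1)]
    by (intro conjI exI[of _ ?U]) blast+
qed

section \<open>Stability\<close>

lemma infdist_level_tendsto:
  assumes lift: "polar_lift X th f" and "k \<in> {1..n}" and lim: "(f \<longlongrightarrow> l) F" "exp l = radius k"
  shows "((\<lambda>t. infdist (X t) (level (radius k))) \<longlongrightarrow> 0) F"
proof (rule tendsto_sandwich[of "\<lambda>_. 0" _ F "\<lambda>t. C * \<bar>exp (f t) - radius k\<bar>"])
  have "((\<lambda>t. exp (f t)) \<longlongrightarrow> exp l) F" using lim(1) by (rule tendsto_exp)
  then have "((\<lambda>t. C * \<bar>exp (f t) - radius k\<bar>) \<longlongrightarrow> C * \<bar>exp l - radius k\<bar>) F"
    by (intro tendsto_mult tendsto_const tendsto_rabs tendsto_diff)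
  then show "((\<lambda>t. C * \<bar>exp (f t) - radius k\<bar>) \<longlongrightarrow> 0) F" using lim(2) by simp
  show "\<forall>\<^sub>F t in F. infdist (X t) (level (radius k)) \<le> C * \<bar>exp (f t) - radius k\<bar>"
    using infdist_level[OF lift_nonzero[OF lift] radius_pos[OF assms(2)]] lift_N[OF lift] by simp
qed (simp_all add: infdist_nonneg)

text \<open>The barrier keeps \<open>N\<close> at or above radius k, so the limit of
  \<open>N\<close> is a radius in [radius k, radius (k + 1)), which can only be radius k.\<close>

lemma level_stable_exterior:
  assumes k: "k \<in> {1..n}"
  shows "stable_exterior n g (level (radius k))"
proof -
  obtain e where e: "e > 0"
    "\<And>p. infdist p (level (radius k)) < e \<Longrightarrow> radius (k - 1) < N p \<and> N p < radius (k + 1)"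
    using level_neighbourhood[OF k] by blast
  have "((\<lambda>t. infdist (X t) (level (radius k))) \<longlongrightarrow> 0) at_top"
    if p: "p \<in> outside (level (radius k))" "infdist p (level (radius k)) < e"
      and X: "pw_solution n g X" "X 0 = p" for p X
  proof -
    have Np: "radius k < N p" "N p < radius (k + 1)"
      using p e(2) outside_level[OF radius_pos[OF k]] by auto
    then have "p \<noteq> 0" using radius_pos[OF k] by auto
    then obtain th f where lift: "polar_lift X th f" using polar_lift_exists[OF X(1)] X(2) by blast
    have ge: "f t \<ge> ln (radius k)" for t
    proof -
      have "N (X t) \<ge> radius k"
      proof (cases "t \<ge> 0")
        case True
        then show ?thesis using barrier[OF lift k, of 0 t] Np(1) X(2) by simp
      next
        case False
        then show ?thesis using f_antimono[OF lift, of t 0] Np(1) X(2) lift_N[OF lift] 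
          by (metis exp_le_cancel_iff less_eq_real_def linear order_trans)
      qed
      then have "exp (ln (radius k)) \<le> exp (f t)" using radius_pos[OF k] by (simp add: lift_N[OF lift])
      then show ?thesis by (simp only: exp_le_cancel_iff)
    qed
    obtain l where l: "ln (radius k) \<le> l" "\<And>t. l \<le> f t" "(f \<longlongrightarrow> l) at_top"
      by (rule antimono_tendsto_at_top[of f, OF f_antimono[OF lift] ge]) (assumption, rule that)
    obtain j where j: "j \<in> {1..n}" "exp l = radius j" by (rule limit_radius_at_top[OF lift l(3)])
    have "exp (ln (radius k)) \<le> exp l" using l(1) by (simp only: exp_le_cancel_iff)
    then have "radius k \<le> radius j" using radius_pos[OF k] by (simp add: j(2))
    moreover have "radius j \<le> N p" using l(2)[of 0] X(2) lift_N[OF lift, of 0] by (simp flip: j(2))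
    ultimately have "j = k" using Np(2) by (intro radius_between(2)) auto
    then show ?thesis using infdist_level_tendsto[OF lift k l(3)] j(2) by simp
  qed
  moreover have "\<exists>X. pw_solution n g X \<and> X 0 = p" if "p \<in> outside (level (radius k))" for p
  proof -
    have "p \<noteq> 0" using that outside_level[OF radius_pos[OF k]] radius_pos[OF k] by auto
    then show ?thesis using solution_exists by blast
  qed
  ultimately show ?thesis
    unfolding stable_exterior_def attracts_from_def using e(1) by blast
qed

text \<open>Read backwards, the barrier says that a solution inside the cycle at time 0 was inside
  at all earlier times. Its gauge thus increases into the past up to a radius in (radius (k - 1),
  radius k].\<close>

lemma level_unstable_interior:
  assumes k: "k \<in> {1..n}"
  shows "unstable_interior n g (level (radius k))"
proof -
  obtain e where e: "e > 0"
    "\<And>p. infdist p (level (radius k)) < e \<Longrightarrow> radius (k - 1) < N p \<and> N p < radius (k + 1)"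
    using level_neighbourhood[OF k] by blast
  have r0: "radius (k - 1) \<ge> 0" by (simp add: radius_def)
  have nz: "p \<noteq> 0" if "infdist p (level (radius k)) < e" for p using e(2)[OF that] r0 by auto
  have "((\<lambda>t. infdist (X t) (level (radius k))) \<longlongrightarrow> 0) at_bot"
    if p: "p \<in> inside (level (radius k))" "infdist p (level (radius k)) < e"
      and X: "pw_solution n g X" "X 0 = p" for p X
  proof -
    have Np: "N p < radius k" "radius (k - 1) < N p"
      using p e(2) inside_level[OF radius_pos[OF k]] by auto
    obtain th f where lift: "polar_lift X th f" using polar_lift_exists[OF X(1)] X(2) nz[OF p(2)] by blast
    have le: "f t \<le> ln (radius k)" for t
    proof -
      have "N (X t) \<le> radius k"
      proof (cases "t \<ge> 0")
        case True
        then have "N (X t) \<le> N (X 0)" using f_antimono[OF lift, of 0 t] by (simp add: lift_N[OF lift])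
        then show ?thesis using Np(1) X(2) by simp
      next
        case False
        then show ?thesis using barrier[OF lift k, of t 0] Np(1) X(2) by (auto simp: not_le[symmetric])
      qed
      then show ?thesis using radius_pos[OF k] by (simp add: lift_N[OF lift] ln_ge_iff)
    qed
    obtain l where l: "l \<le> ln (radius k)" "\<And>t. f t \<le> l" "(f \<longlongrightarrow> l) at_bot"
      by (rule antimono_tendsto_at_bot[of f, OF f_antimono[OF lift] le]) (assumption, rule that)
    obtain j where j: "j \<in> {1..n}" "exp l = radius j" by (rule limit_radius_at_bot[OF lift l(3)])
    have "radius j \<le> radius k" using l(1) radius_pos[OF k] by (simp add: ln_ge_iff flip: j(2))
    moreover have "N p \<le> radius j" using l(2)[of 0] X(2) lift_N[OF lift, of 0] by (simp flip: j(2))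
    ultimately have "j = k" using Np(2) by (intro radius_between(1)) auto
    then show ?thesis using infdist_level_tendsto[OF lift k l(3)] j(2) by simp
  qed
  moreover have "\<exists>X. pw_solution n g X \<and> X 0 = p" if "infdist p (level (radius k)) < e" for p
    using nz[OF that] solution_exists by blast
  ultimately show ?thesis
    unfolding unstable_interior_def attracts_from_def using e(1) by blast
qed

text \<open>The points \<open>p\<close> and \<open>- i W p\<close> lie in the same half-plane \<open>x > 0\<close> or \<open>x < 0\<close>, or agree on the
  \<open>y\<close>-axis, so their polar angles differ by less than \<open>\<pi>\<close>.\<close>
lemma lift_spirals:
  assumes lift: "polar_lift X th f"
  shows "spirals_around_origin X"
proof -
  define z where "z t = Complex (X t $ 1) (X t $ 2)" for t
  define v where "v t = - \<i> * W (X t)" for t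
  have v: "v t = Complex (X t $ 1) (X t $ 2 - g * \<bar>X t $ 1\<bar>)" for t
    by (simp add: v_def complex_eq_iff)
  have nz: "X t \<noteq> 0" for t using lift_nonzero[OF lift] .
  have v0: "v t \<noteq> 0" for t using nz by (simp add: v_def)
  have quot: "z t / v t \<notin> \<real>\<^sub>\<le>\<^sub>0" for t
  proof
    assume "z t / v t \<in> \<real>\<^sub>\<le>\<^sub>0"
    then obtain r where r: "r \<le> 0" "z t / v t = of_real r"
      by (auto simp: complex_nonpos_Reals_iff complex_is_Real_iff elim!: nonpos_Reals_cases)
    then have zv: "z t = of_real r * v t" using v0[of t] by (simp add: divide_eq_eq)
    have "X t $ 1 = r * X t $ 1" "X t $ 2 = r * (X t $ 2 - g * \<bar>X t $ 1\<bar>)"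
      using arg_cong[OF zv, of Re] arg_cong[OF zv, of Im] by (simp_all add: z_def v)
    then have "(1 - r) * X t $ 1 = 0" and y: "X t $ 2 = r * (X t $ 2 - g * \<bar>X t $ 1\<bar>)"
      by (simp_all add: algebra_simps)
    then have "X t $ 1 = 0" using r(1) by simp
    with y have "(1 - r) * X t $ 2 = 0" by (simp add: algebra_simps)
    then have "X t $ 2 = 0" using r(1) by simp
    with \<open>X t $ 1 = 0\<close> show False using nz[of t] by (auto simp: vec_eq_iff forall_2)
  qed
  define q where "q t = Ln (z t / v t)" for t
  \<comment> \<open>The argument of - i is - pi / 2, so \<open>th t - pi / 2\<close> is an argument
    of \<open>v t\<close>; adding the imaginary part of \<open>q t\<close> makes it one of
    \<open>z t\<close>.\<close>
  define \<theta> where "\<theta> t = th t - pi / 2 + Im (q t)" for t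
  have z0: "z t \<noteq> 0" for t using quot[of t] by auto
  have contX: "continuous_on S X" for S using lift_X_continuous[OF lift] .
  have "continuous_on {0..} z" "continuous_on {0..} v"
    unfolding z_def v Complex_eq by (intro continuous_intros contX)+
  then have "continuous_on {0..} q"
    unfolding q_def using quot v0 by (intro continuous_on_Ln' continuous_on_divide) auto
  then have "continuous_on {0..} \<theta>"
    unfolding \<theta>_def by (intro continuous_intros th_continuous[OF lift])
  moreover have "X t = norm (X t) *\<^sub>R vector [cos (\<theta> t), sin (\<theta> t)]" for t
  proof -
    have "z t = v t * exp (q t)" using z0[of t] v0[of t] by (simp add: q_def)
    also have "v t = of_real (exp (f t + g * arccos (cos (th t)))) * cis (th t - pi / 2)"
    proof -
      have e: "- \<i> * cis (th t) = cis (th t - pi / 2)"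
        by (simp add: complex_eq_iff cos_diff sin_diff)
      show ?thesis unfolding v_def lift_W[OF lift] by (simp only: mult.left_commute[of "- \<i>"] e)
    qed
    also have "exp (q t) = of_real (exp (Re (q t))) * cis (Im (q t))" by (simp add: exp_eq_polar)
    finally have "z t = of_real (exp (f t + g * arccos (cos (th t))) * exp (Re (q t))) * (cis (th t - pi / 2) * cis (Im (q t)))"
      by (simp add: mult_ac)
    then have zt: "z t = of_real (exp (f t + g * arccos (cos (th t))) * exp (Re (q t))) * cis (\<theta> t)"
      by (simp add: cis_mult \<theta>_def)
    have "norm (X t) = cmod (z t)"
      by (simp add: norm_vec_def L2_set_def sum_2 z_def complex_norm)
    also have "\<dots> = exp (f t + g * arccos (cos (th t))) * exp (Re (q t))"
      unfolding zt by (simp add: norm_mult)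
    finally have nX: "norm (X t) = exp (f t + g * arccos (cos (th t))) * exp (Re (q t))" .
    have "X t $ 1 = norm (X t) * cos (\<theta> t)" "X t $ 2 = norm (X t) * sin (\<theta> t)"
      using arg_cong[OF zt, of Re] arg_cong[OF zt, of Im] by (simp_all add: nX z_def)
    then show ?thesis by (simp add: vec_eq_iff forall_2)
  qed
  moreover have "filterlim \<theta> at_top at_top"
  proof (rule filterlim_at_top_mono)
    show "filterlim (\<lambda>t. (th 0 - 3 * pi / 2) + t) at_top at_top"
      by (rule filterlim_tendsto_add_at_top[OF tendsto_const filterlim_ident])
    have "(th 0 - 3 * pi / 2) + t \<le> \<theta> t" if "t \<ge> 0" for t
    proof -
      have "Im (q t) > - pi" unfolding q_def using z0[of t] v0[of t] by (intro mpi_less_Im_Ln) simp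
      then show ?thesis using th_expanding[OF lift, of 0 t] that by (simp add: \<theta>_def)
    qed
    then show "\<forall>\<^sub>F t in at_top. (th 0 - 3 * pi / 2) + t \<le> \<theta> t"
      unfolding eventually_at_top_linorder by blast
  qed
  ultimately show ?thesis
    unfolding spirals_around_origin_def using nz by (intro exI[of _ \<theta>]) blast
qed

text \<open>Below the smallest radius no positive limit of the gauge is possible. The limit is taken
  for exp f, because \<open>f\<close> itself tends to minus infinity.\<close>

lemma origin_stable_focus: "stable_focus_at_origin n g"
proof -
  have zero: "pw_solution n g (\<lambda>_. 0)"
  proof -
    have "pw_field n g 0 = 0" by (simp add: pw_field_eq vec_eq_iff forall_2)
    then show ?thesis by (simp add: pw_solution_def)
  qed
  obtain e where e: "e > 0" "\<And>p. norm p < e \<Longrightarrow> N p < radius 1"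
  proof -
    have "open {p. N p < radius 1}" using continuous_on_N by (intro open_Collect_less) auto
    moreover have "0 \<in> {p. N p < radius 1}" by (simp add: radius_def)
    ultimately obtain e where "e > 0" "ball 0 e \<subseteq> {p. N p < radius 1}" by (rule openE)
    then show thesis using that[of e] by (auto simp: subset_iff)
  qed
  have "spirals_around_origin X \<and> (X \<longlongrightarrow> 0) at_top"
    if p: "p \<noteq> 0" "norm p < e" and X: "pw_solution n g X" "X 0 = p" for p X
  proof -
    obtain th f where lift: "polar_lift X th f" using polar_lift_exists[OF X(1)] X(2) p(1) by blast
    obtain l where l: "0 \<le> l" "\<And>t. l \<le> exp (f t)" "((\<lambda>t. exp (f t)) \<longlongrightarrow> l) at_top"
      by (rule antimono_tendsto_at_top[of "\<lambda>t. exp (f t)" 0]) (use f_antimono[OF lift] in auto)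
    have "l = 0"
    proof (rule ccontr)
      assume "l \<noteq> 0"
      then have "((\<lambda>t. ln (exp (f t))) \<longlongrightarrow> ln l) at_top" using l(3) by (intro tendsto_ln) auto
      then have "(f \<longlongrightarrow> ln l) at_top" by simp
      then obtain j where "j \<in> {1..n}" "exp (ln l) = radius j" by (rule limit_radius_at_top[OF lift])
      then have "radius 1 \<le> l" using l(1) \<open>l \<noteq> 0\<close> by (simp add: radius_def)
      moreover have "l \<le> N p" using l(2)[of 0] X(2) lift_N[OF lift, of 0] by simp
      ultimately show False using e(2)[OF p(2)] by simp
    qed
    have "(X \<longlongrightarrow> 0) at_top"
    proof (rule Lim_null_comparison)
      have "norm (X t) \<le> C * exp (f t)" for t
        using norm_le_N[of "X t"] by (simp add: C_def lift_N[OF lift])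
      then show "\<forall>\<^sub>F t in at_top. norm (X t) \<le> C * exp (f t)" by simp
      show "((\<lambda>t. C * exp (f t)) \<longlongrightarrow> 0) at_top"
        using tendsto_mult_right_zero[OF l(3)[unfolded \<open>l = 0\<close>], of C] .
    qed
    then show ?thesis using lift_spirals[OF lift] by blast
  qed
  moreover have "\<exists>X. pw_solution n g X \<and> X 0 = p" if "p \<noteq> 0" for p
    using solution_exists[OF that] by blast
  ultimately show ?thesis
    unfolding stable_focus_at_origin_def using zero e(1) by (intro conjI exI[of _ e]) auto
qed

end

theorem corollary5:
  fixes n :: nat and \<gamma> :: real
  assumes "n \<ge> 1" and "0 < \<gamma>" and "\<gamma> < sqrt (3 / 13)"
  shows "card {\<Gamma>. limit_cycle n \<gamma> \<Gamma>} = n \<and>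
    nested {\<Gamma>. limit_cycle n \<gamma> \<Gamma>} \<and>
    (\<forall>\<Gamma>. limit_cycle n \<gamma> \<Gamma> \<longrightarrow> 0 \<in> inside \<Gamma>) \<and>
    stable_focus_at_origin n \<gamma> \<and>
    (\<exists>C. bij_betw C {1..n} {\<Gamma>. limit_cycle n \<gamma> \<Gamma>} \<and>
      (\<forall>k\<in>{1..n}. C k \<inter> {p. p $ 1 = 0} =
        {vector [0, 2 * real k], vector [0, - 2 * real k * exp (- pi * \<gamma>)]})) \<and>
    (\<forall>\<Gamma>. limit_cycle n \<gamma> \<Gamma> \<longrightarrow> semi_stable n \<gamma> \<Gamma>)"
proof -
  have "\<gamma>\<^sup>2 < (sqrt (3 / 13))\<^sup>2" using assms by (intro power_strict_mono) auto
  then interpret two_zone n \<gamma> using assms by unfold_locales simp_all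
  let ?L = "\<lambda>k. level (radius k)"
  have eq: "{\<Gamma>. limit_cycle n \<gamma> \<Gamma>} = ?L ` {1..n}" by (auto simp: limit_cycle_iff)
  have "inj_on ?L {1..n}"
  proof (rule inj_onI)
    fix j k assume "j \<in> {1..n}" "k \<in> {1..n}" "?L j = ?L k"
    then obtain p where "p \<in> ?L j" "p \<in> ?L k" using level_nonempty[OF radius_pos[of j]] by blast
    then show "j = k" by (simp add: level_def radius_inj)
  qed
  then have bij: "bij_betw ?L {1..n} {\<Gamma>. limit_cycle n \<gamma> \<Gamma>}" by (simp add: bij_betw_def eq)
  have "card {\<Gamma>. limit_cycle n \<gamma> \<Gamma>} = n" using bij_betw_same_card[OF bij] by simp
  moreover have "nested {\<Gamma>. limit_cycle n \<gamma> \<Gamma>}"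
  proof -
    have "?L j \<union> inside (?L j) \<subseteq> inside (?L k)" if "j < k" "j \<in> {1..n}" "k \<in> {1..n}" for j k
      using that(1) unfolding inside_level[OF radius_pos[OF that(2)]] inside_level[OF radius_pos[OF that(3)]]
      unfolding level_def by (auto simp flip: radius_less_iff)
    then show ?thesis unfolding nested_def eq by (intro ballI impI) (elim imageE, metis linorder_neqE_nat)
  qed
  moreover have "\<forall>\<Gamma>. limit_cycle n \<gamma> \<Gamma> \<longrightarrow> 0 \<in> inside \<Gamma>"
    by (auto simp: limit_cycle_iff inside_level radius_pos)
  moreover have "\<forall>\<Gamma>. limit_cycle n \<gamma> \<Gamma> \<longrightarrow> semi_stable n \<gamma> \<Gamma>"
    unfolding limit_cycle_iff semi_stable_def
    using level_stable_exterior level_unstable_interior by blast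
  ultimately show ?thesis
    using origin_stable_focus bij level_Int_axis by (intro conjI exI[of _ ?L]) blast+
qed

end
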